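(* Let $d\ge3$, $V=\{1,\dots,d\}$, and let $\boldsymbol Y$ have a Hüsler–Reiss Pareto distribution with parameter matrix $\Gamma$. Then for all $i,j\in V$ with $i\ne j$ and for any $k\in V$, $$Y_i\perp_e Y_j\mid\boldsymbol Y_{\setminus\{i,j\}}\quad\Longleftrightarrow\quad\begin{cases}\Theta^{(k)}_{ij}=0,&\text{if } i,j\neq k,\\ \sum_{l\ne k}\Theta^{(k)}_{lj}=0,&\text{if } i=k,\ j\ne k,\\ \sum_{l\ne k}\Theta^{(k)}_{il}=0,&\text{if } j=k,\ i\ne k,\end{cases}$$ where the sums run over $l\in V\setminus\{k\}$.
   Context: Parameter matrix: $\Gamma=(\Gamma_{ij})_{i,j\in V}$ is symmetric with non-negative entries, zero diagonal, and strictly conditionally negative definite, i.e. $\boldsymbol a^\top\Gamma\boldsymbol a<0$ for all non-zero $\boldsymbol a\in\mathbb R^d$ with $\sum_i a_i=0$. For $k\in V$, $\Sigma^{(k)}=\tfrac12\{\Gamma_{ik}+\Gamma_{jk}-\Gamma_{ij}\}_{i,j\neq k}$ is the (strictly positive definite) $(d-1)\times(d-1)$ matrix indexed by $V\setminus\{k\}$, and $\Theta^{(k)}=(\Sigma^{(k)})^{-1}$, also indexed by $V\setminus\{k\}$. Hüsler–Reiss exponent measure density: for any $k\in V$ (the value does not depend on $k$), $$\lambda(\boldsymbol y)=y_k^{-2}\prod_{i\ne k}y_i^{-1}\,\phi_{d-1}\big(\tilde{\boldsymbol y}_{\setminus k};\Sigma^{(k)}\big),\qquad \tilde y_i=\log(y_i/y_k)+\Gamma_{ik}/2,\quad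 \boldsymbol y\in(0,\infty)^d,$$ where $\phi_p(\cdot;\Sigma)$ is the density of the centred $p$-dimensional normal distribution with covariance matrix $\Sigma$. The Hüsler–Reiss Pareto distribution $\boldsymbol Y$ has density $\lambda(\boldsymbol y)/\Lambda(\boldsymbol 1)$ on $\mathcal L=\{\boldsymbol x\in[0,\infty)^d:\|\boldsymbol x\|_\infty>1\}$, with $\Lambda(\boldsymbol 1)=\int_{\mathcal L}\lambda(\boldsymbol y)\,\mathrm d\boldsymbol y<\infty$. For $m\in V$, $\boldsymbol Y^m$ is $\boldsymbol Y$ conditioned on $\{Y_m>1\}$. $Y_i\perp_e Y_j\mid\boldsymbol Y_{\setminus\{i,j\}}$ means that for every $m\in V$, $Y_i^m$ and $Y_j^m$ are conditionally independent given $\boldsymbol Y^m_{\setminus\{i,j\}}=(Y^m_l)_{l\in V\setminus\{i,j\}}$ in the usual sense. *)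

theory Defs
  imports "HOL-Probability.Probability"
begin

section \<open>Matrices indexed by a subset of a type\<close>

text \<open>
  The matrices $\Sigma^{(k)}$ and $\Theta^{(k)}$ have index set $V \setminus \{k\}$, which is
  not a type. A matrix with index set $I$ is a function of two indices of which only the
  values on $I \times I$ are relevant; the two notions below are the relativisations to $I$ of
  \<^const>\<open>det\<close> and \<^const>\<open>matrix_inv\<close>.
\<close>

definition det_on :: "'i set \<Rightarrow> ('i \<Rightarrow> 'i \<Rightarrow> real) \<Rightarrow> real" where
  "det_on I A = (\<Sum>p | p permutes I. of_int (sign p) * (\<Prod>i\<in>I. A i (p i)))"

definition matrix_inv_on :: "'i set \<Rightarrow> ('i \<Rightarrow> 'i \<Rightarrow> real) \<Rightarrow> 'i \<Rightarrow> 'i \<Rightarrow> real" where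
  "matrix_inv_on I A = (SOME B. \<forall>i\<in>I. \<forall>j\<in>I.
     (\<Sum>l\<in>I. A i l * B l j) = (if i = j then 1 else 0) \<and>
     (\<Sum>l\<in>I. B i l * A l j) = (if i = j then 1 else 0))"

definition mvn_density :: "'i set \<Rightarrow> ('i \<Rightarrow> 'i \<Rightarrow> real) \<Rightarrow> ('i \<Rightarrow> real) \<Rightarrow> real" where
  "mvn_density I S x =
     exp (- (\<Sum>i\<in>I. \<Sum>j\<in>I. x i * matrix_inv_on I S i j * x j) / 2)
       / sqrt ((2 * pi) ^ card I * det_on I S)"


section \<open>Huesler--Reiss Pareto distributions\<close>

text \<open>The index set $V$ is the universe of the finite type \<open>'n\<close>.\<close>

definition HR_parameter_matrix :: "real^'n^'n \<Rightarrow> bool" where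
  "HR_parameter_matrix \<Gamma> \<longleftrightarrow>
     transpose \<Gamma> = \<Gamma> \<and> (\<forall>i j. 0 \<le> \<Gamma> $ i $ j) \<and> (\<forall>i. \<Gamma> $ i $ i = 0) \<and>
     (\<forall>a. a \<noteq> 0 \<longrightarrow> (\<Sum>i\<in>UNIV. a $ i) = 0 \<longrightarrow> a \<bullet> (\<Gamma> *v a) < 0)"

definition HR_Sigma :: "real^'n^'n \<Rightarrow> 'n \<Rightarrow> 'n \<Rightarrow> 'n \<Rightarrow> real" where
  "HR_Sigma \<Gamma> k i j = (\<Gamma> $ i $ k + \<Gamma> $ j $ k - \<Gamma> $ i $ j) / 2"

definition HR_Theta :: "real^'n^'n \<Rightarrow> 'n \<Rightarrow> 'n \<Rightarrow> 'n \<Rightarrow> real" where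
  "HR_Theta \<Gamma> k = matrix_inv_on (UNIV - {k}) (HR_Sigma \<Gamma> k)"

text \<open>
  The exponent measure density, written in terms of the index \<open>k\<close>, and extended by zero
  outside the open positive orthant. Its value does not depend on \<open>k\<close>, but this is a theorem
  about parameter matrices; \<open>k\<close> is therefore kept as an explicit argument of the notions
  derived from the density.
\<close>

definition HR_exponent_density :: "real^'n^'n \<Rightarrow> 'n \<Rightarrow> real^'n \<Rightarrow> real" where
  "HR_exponent_density \<Gamma> k y =
     (if \<forall>i. 0 < y $ i
      then inverse ((y $ k)\<^sup>2) * (\<Prod>i\<in>UNIV - {k}. inverse (y $ i)) *
           mvn_density (UNIV - {k}) (HR_Sigma \<Gamma> k) (\<lambda>i. ln (y $ i / y $ k) + \<Gamma> $ i $ k / 2)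
      else 0)"

definition Pareto_support :: "(real^'n) set" where
  "Pareto_support = {x. (\<forall>i. 0 \<le> x $ i) \<and> infnorm x > 1}"

definition HR_Lambda_one :: "real^'n^'n \<Rightarrow> 'n \<Rightarrow> ennreal" where
  "HR_Lambda_one \<Gamma> k =
     (\<integral>\<^sup>+y\<in>Pareto_support. ennreal (HR_exponent_density \<Gamma> k y) \<partial>lborel)"

definition HR_Pareto :: "'a measure \<Rightarrow> ('a \<Rightarrow> real^'n) \<Rightarrow> real^'n^'n \<Rightarrow> 'n \<Rightarrow> bool" where
  "HR_Pareto M Y \<Gamma> k \<longleftrightarrow>
     distributed M lborel Y
       (\<lambda>y. ennreal (HR_exponent_density \<Gamma> k y) / HR_Lambda_one \<Gamma> k * indicator Pareto_support y)"


section \<open>Conditional independence\<close>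

text \<open>
  Conditional independence of the random variables \<open>X\<close> and \<open>Z\<close> given (the sigma-algebra
  generated by) the random variable \<open>W\<close>; the measures \<open>N\<^sub>1\<close>, \<open>N\<^sub>2\<close>, \<open>N\<^sub>3\<close> only serve to specify
  the measurable spaces in which \<open>X\<close>, \<open>Z\<close>, \<open>W\<close> take their values.
\<close>

definition cond_indep_var ::
  "'a measure \<Rightarrow> 'b measure \<Rightarrow> ('a \<Rightarrow> 'b) \<Rightarrow> 'c measure \<Rightarrow> ('a \<Rightarrow> 'c) \<Rightarrow> 'd measure \<Rightarrow> ('a \<Rightarrow> 'd) \<Rightarrow> bool"
  where
  "cond_indep_var M N\<^sub>1 X N\<^sub>2 Z N\<^sub>3 W \<longleftrightarrow>
     (let F = vimage_algebra (space M) W N\<^sub>3 in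
      \<forall>A\<in>sets N\<^sub>1. \<forall>B\<in>sets N\<^sub>2. AE \<omega> in M.
        real_cond_exp M F (indicator (X -` A \<inter> Z -` B)) \<omega> =
        real_cond_exp M F (indicator (X -` A)) \<omega> * real_cond_exp M F (indicator (Z -` B)) \<omega>)"

text \<open>
  The vector $Y^m$ is realised as \<open>Y\<close> itself under the conditional probability measure given
  the event $\{Y_m > 1\}$.
\<close>

definition extremal_cond_indep :: "'a measure \<Rightarrow> ('a \<Rightarrow> real^'n) \<Rightarrow> 'n \<Rightarrow> 'n \<Rightarrow> bool" where
  "extremal_cond_indep M Y i j \<longleftrightarrow>
     (\<forall>m. cond_indep_var (uniform_measure M {\<omega> \<in> space M. Y \<omega> $ m > 1})
            borel (\<lambda>\<omega>. Y \<omega> $ i)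
            borel (\<lambda>\<omega>. Y \<omega> $ j)
            (\<Pi>\<^sub>M l\<in>UNIV - {i, j}. borel) (\<lambda>\<omega>. \<lambda>l\<in>UNIV - {i, j}. Y \<omega> $ l))"

end

theory Submission
  imports Defs
begin

text \<open>
  In the coordinates $u = \log y$ the exponent measure density is the exponential of a quadratic
  polynomial, and the coefficient of $u_i u_j$ in it is, up to sign, the entry $T_{ij}$ of the
  matrix $T$ that extends $\Theta^{(k)}$ to $V$ with zero row and column sums. This matrix does not
  depend on $k$. Restricting to $\{y_m > 1\}$ multiplies the density by a function of one coordinate.
  With all coordinates except $x = y_i$ and $z = y_j$ fixed, the density $\kappa$ therefore satisfies
  \[\kappa(x,z)\,\kappa(2,2) = \kappa(x,2)\,\kappa(2,z)\,
    \exp\bigl(-T_{ij}\,(\log x - \log 2)(\log z - \log 2)\bigr).\]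
  If $T_{ij} = 0$, it factorises and the two coordinates are conditionally independent. Otherwise
  choose $m \notin \{i,j\}$: conditional independence would force
  $\mu(U \times U)\,\mu(V \times V) = \mu(U \times V)\,\mu(V \times U)$ for the conditional masses
  $\mu$ of products of intervals, which fails for $U$ and $V$ on either side of 2.
\<close>

section \<open>The precision matrix\<close>

text \<open>Comparing two indices is unavoidable: the density is written with one index, the
  criterion with another, arbitrary one. The obstacle in the converse is that conditional
  independence gives, for each fixed pair of Borel sets, an identity outside a null set that depends
  on the pair, so nothing can be evaluated pointwise in \<open>x\<close> and \<open>z\<close>. Four
  rectangles avoid this: the one-dimensional marginal masses cancel in their cross ratio, and a
  bound on the interaction factor over each rectangle becomes a strict inequality between masses.
  The reference point 2 exceeds 1, so it satisfies the truncation even when \<open>m\<close> is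
  \<open>i\<close> or \<open>j\<close>; a density that vanishes at (2, 2) therefore vanishes along
  the whole fibre. Identities are kept in multiplied-out form, since a density value may be 0 and a
  fibre mass may be 0 or infinite on an exceptional set.\<close>

lemma matrix_inv_on_inverse:
  assumes "\<exists>B. \<forall>i\<in>I. \<forall>j\<in>I.
     (\<Sum>l\<in>I. A i l * B l j) = (if i = j then 1 else 0) \<and>
     (\<Sum>l\<in>I. B i l * A l j) = (if i = j then 1 else 0)"
    and "i \<in> I" "j \<in> I"
  shows "(\<Sum>l\<in>I. A i l * matrix_inv_on I A l j) = (if i = j then 1 else 0)"
    and "(\<Sum>l\<in>I. matrix_inv_on I A i l * A l j) = (if i = j then 1 else 0)"
  using someI_ex[OF assms(1), folded matrix_inv_on_def] assms(2,3) by simp_all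

lemma HR_parameter_matrix_sym: "HR_parameter_matrix \<Gamma> \<Longrightarrow> \<Gamma> $ a $ b = \<Gamma> $ b $ a"
  unfolding HR_parameter_matrix_def transpose_def by (metis vec_lambda_beta)

lemma HR_parameter_matrix_diag: "HR_parameter_matrix \<Gamma> \<Longrightarrow> \<Gamma> $ k $ k = 0"
  unfolding HR_parameter_matrix_def by blast

lemma HR_Sigma_sym: "HR_parameter_matrix \<Gamma> \<Longrightarrow> HR_Sigma \<Gamma> k a b = HR_Sigma \<Gamma> k b a"
  using HR_parameter_matrix_sym[of \<Gamma> a b] by (simp add: HR_Sigma_def)

section \<open>Invertibility of \<Sigma> and symmetry of its inverse\<close>

text \<open>Moving the total of \<open>x\<close> into coordinate \<open>k\<close> with a negative
  sign gives a vector \<open>a\<close> with zero sum. The equations off \<open>k\<close> say that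
  \<Gamma> maps \<open>a\<close> to a constant vector, so the quadratic form vanishes at
  \<open>a\<close>, and strict conditional negative definiteness forces
  \<open>a = 0\<close>.\<close>

lemma HR_Sigma_kernel:
  fixes \<Gamma> :: "real^'n^'n"
  assumes \<Gamma>: "HR_parameter_matrix \<Gamma>" and x: "x $ k = 0"
    and eq: "\<And>b. b \<noteq> k \<Longrightarrow> (\<Sum>c\<in>UNIV. HR_Sigma \<Gamma> k b c * x $ c) = 0"
  shows "x = 0"
proof (rule ccontr)
  assume "x \<noteq> 0"
  define s where "s = (\<Sum>c\<in>UNIV. x $ c)"
  define \<gamma> where "\<gamma> = (\<Sum>c\<in>UNIV. \<Gamma> $ c $ k * x $ c)"
  define a where "a = x - axis k s"
  note sym = HR_parameter_matrix_sym[OF \<Gamma>] and diag = HR_parameter_matrix_diag[OF \<Gamma>]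
  have "(\<Gamma> *v a) $ b = \<gamma>" for b
  proof -
    have "(\<Gamma> *v axis k s) $ b = \<Gamma> $ b $ k * s"
      by (simp add: matrix_vector_mult_def axis_def if_distrib cong: if_cong)
    moreover have "(\<Gamma> *v x) $ b = \<Gamma> $ b $ k * s + \<gamma>"
    proof (cases "b = k")
      case True
      have "(\<Gamma> *v x) $ k = \<gamma>"
        by (auto simp: matrix_vector_mult_def \<gamma>_def intro!: sum.cong sym)
      then show ?thesis by (simp add: True diag)
    next
      case False
      have "2 * (\<Sum>c\<in>UNIV. HR_Sigma \<Gamma> k b c * x $ c)
          = (\<Sum>c\<in>UNIV. (\<Gamma> $ b $ k + \<Gamma> $ c $ k - \<Gamma> $ b $ c) * x $ c)"
        by (simp add: sum_distrib_left HR_Sigma_def)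
      also have "\<dots> = \<Gamma> $ b $ k * s + \<gamma> - (\<Gamma> *v x) $ b"
        unfolding s_def \<gamma>_def matrix_vector_mult_def
        by (simp add: sum_distrib_left sum.distrib sum_subtractf distrib_right left_diff_distrib)
      finally show ?thesis using eq[OF False] by simp
    qed
    ultimately show ?thesis by (simp add: a_def matrix_vector_mult_diff_distrib)
  qed
  moreover have sa: "(\<Sum>c\<in>UNIV. a $ c) = 0"
    by (simp add: a_def s_def sum_subtractf axis_def)
  ultimately have "a \<bullet> (\<Gamma> *v a) = 0"
    by (simp add: inner_vec_def flip: sum_distrib_right)
  then have "a = 0" using \<Gamma> sa unfolding HR_parameter_matrix_def by force
  then have "x $ c = (axis k s) $ c" for c unfolding a_def by simp
  then have "x $ c = 0" for c using x by (cases "c = k") (auto simp: axis_def)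
  then show False using \<open>x \<noteq> 0\<close> by (simp add: vec_eq_iff)
qed

text \<open>\<open>matrix_inv_on\<close> is a choice, so nothing is known about \<Theta> until some
  two-sided inverse exists. A unit row and column at \<open>k\<close> turn \<Sigma> into a square
  matrix over the whole type with trivial kernel. Its inverse can be restricted to the other
  indices, because the border is zero there.\<close>

lemma HR_Sigma_invertible:
  fixes \<Gamma> :: "real^'n^'n"
  assumes \<Gamma>: "HR_parameter_matrix \<Gamma>"
  shows "\<exists>B. \<forall>i\<in>UNIV - {k}. \<forall>j\<in>UNIV - {k}.
     (\<Sum>l\<in>UNIV - {k}. HR_Sigma \<Gamma> k i l * B l j) = (if i = j then 1 else 0) \<and>
     (\<Sum>l\<in>UNIV - {k}. B i l * HR_Sigma \<Gamma> k l j) = (if i = j then 1 else 0)"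
proof -
  define S :: "real^'n^'n" where
    "S = (\<chi> b c. if b = k \<or> c = k then (if b = c then 1 else 0) else HR_Sigma \<Gamma> k b c)"
  have "x = 0" if Sx: "S *v x = 0" for x
  proof -
    have row: "(\<Sum>c\<in>UNIV. S $ b $ c * x $ c) = 0" for b
      using Sx by (simp add: matrix_vector_mult_def vec_eq_iff)
    have "(\<Sum>c\<in>UNIV. S $ k $ c * x $ c) = (\<Sum>c\<in>UNIV. if c = k then x $ c else 0)"
      by (intro sum.cong) (auto simp: S_def)
    with row[of k] have xk: "x $ k = 0" by simp
    show ?thesis
    proof (rule HR_Sigma_kernel[OF \<Gamma> xk])
      fix b assume "b \<noteq> k"
      then have "(\<Sum>c\<in>UNIV. HR_Sigma \<Gamma> k b c * x $ c) = (\<Sum>c\<in>UNIV. S $ b $ c * x $ c)"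
        by (intro sum.cong) (auto simp: S_def xk)
      then show "(\<Sum>c\<in>UNIV. HR_Sigma \<Gamma> k b c * x $ c) = 0" using row by simp
    qed
  qed
  then have "\<exists>B. B ** S = mat 1"
    by (simp add: matrix_left_invertible_ker)
  then obtain B where B: "B ** S = mat 1" "S ** B = mat 1"
    using matrix_left_right_inverse by blast
  have "(\<Sum>l\<in>UNIV - {k}. HR_Sigma \<Gamma> k i l * B $ l $ j) = (if i = j then 1 else 0)"
    "(\<Sum>l\<in>UNIV - {k}. B $ i $ l * HR_Sigma \<Gamma> k l j) = (if i = j then 1 else 0)"
    if "i \<noteq> k" "j \<noteq> k" for i j
  proof -
    have "(\<Sum>l\<in>UNIV - {k}. HR_Sigma \<Gamma> k i l * B $ l $ j) = (\<Sum>l\<in>UNIV. S $ i $ l * B $ l $ j)"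
      using that by (intro sum.mono_neutral_cong_left) (auto simp: S_def)
    also have "\<dots> = (S ** B) $ i $ j" by (simp add: matrix_matrix_mult_def)
    finally show "(\<Sum>l\<in>UNIV - {k}. HR_Sigma \<Gamma> k i l * B $ l $ j) = (if i = j then 1 else 0)"
      by (simp add: B mat_def)
    have "(\<Sum>l\<in>UNIV - {k}. B $ i $ l * HR_Sigma \<Gamma> k l j) = (\<Sum>l\<in>UNIV. B $ i $ l * S $ l $ j)"
      using that by (intro sum.mono_neutral_cong_left) (auto simp: S_def)
    also have "\<dots> = (B ** S) $ i $ j" by (simp add: matrix_matrix_mult_def)
    finally show "(\<Sum>l\<in>UNIV - {k}. B $ i $ l * HR_Sigma \<Gamma> k l j) = (if i = j then 1 else 0)"
      by (simp add: B mat_def)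
  qed
  then show ?thesis by (intro exI[of _ "\<lambda>i j. B $ i $ j"]) auto
qed

lemma HR_Theta_inverse:
  assumes "HR_parameter_matrix \<Gamma>" "i \<noteq> k" "j \<noteq> k"
  shows "(\<Sum>l\<in>UNIV - {k}. HR_Sigma \<Gamma> k i l * HR_Theta \<Gamma> k l j) = (if i = j then 1 else 0)"
    and "(\<Sum>l\<in>UNIV - {k}. HR_Theta \<Gamma> k i l * HR_Sigma \<Gamma> k l j) = (if i = j then 1 else 0)"
  unfolding HR_Theta_def
  by (rule matrix_inv_on_inverse[OF HR_Sigma_invertible[OF assms(1)]]; use assms(2,3) in simp)+

text \<open>The product of \<Theta>, \<Sigma> and the transpose of \<Theta> collapses from either
  end.\<close>

lemma HR_Theta_sym:
  assumes \<Gamma>: "HR_parameter_matrix \<Gamma>" and ij: "i \<noteq> k" "j \<noteq> k"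
  shows "HR_Theta \<Gamma> k i j = HR_Theta \<Gamma> k j i"
proof -
  let ?I = "UNIV - {k}" and ?T = "HR_Theta \<Gamma> k" and ?S = "HR_Sigma \<Gamma> k"
  note S = HR_Sigma_sym[OF \<Gamma>, of k]
  have T1: "(\<Sum>m\<in>?I. ?S l m * ?T j m) = (if l = j then 1 else 0)" if "l \<noteq> k" for l
    using HR_Theta_inverse(2)[OF \<Gamma> ij(2) that] by (simp add: S[of l] mult.commute eq_commute)
  have "?T i j = (\<Sum>l\<in>?I. ?T i l * (\<Sum>m\<in>?I. ?S l m * ?T j m))"
    using ij by (simp add: T1 if_distrib[of "\<lambda>x. _ * x"] cong: if_cong)
  also have "\<dots> = (\<Sum>m\<in>?I. (\<Sum>l\<in>?I. ?T i l * ?S l m) * ?T j m)"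
    unfolding sum_distrib_left sum_distrib_right by (subst sum.swap) (simp only: mult.assoc)
  also have "\<dots> = ?T j i"
    using ij by (simp add: HR_Theta_inverse[OF \<Gamma>] if_distrib[of "\<lambda>x. x * _"] cong: if_cong)
  finally show ?thesis .
qed

text \<open>
  The bordering of $\Theta^{(k)}$ by a row and a column that make all row and column sums
  vanish: its $(i,j)$ entry is, up to sign, the quantity in the case distinction of the theorem.
\<close>

definition HR_precision :: "real^'n^'n \<Rightarrow> 'n \<Rightarrow> real^'n^'n" where
  "HR_precision \<Gamma> k = (\<chi> a b.
     if a = k then (if b = k then \<Sum>l\<in>UNIV - {k}. \<Sum>m\<in>UNIV - {k}. HR_Theta \<Gamma> k l m
                    else - (\<Sum>l\<in>UNIV - {k}. HR_Theta \<Gamma> k l b))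
     else (if b = k then - (\<Sum>l\<in>UNIV - {k}. HR_Theta \<Gamma> k a l) else HR_Theta \<Gamma> k a b))"

lemma transpose_HR_precision:
  assumes "HR_parameter_matrix \<Gamma>"
  shows "transpose (HR_precision \<Gamma> k) = HR_precision \<Gamma> k"
proof -
  have "HR_precision \<Gamma> k $ b $ a = HR_precision \<Gamma> k $ a $ b" for a b
    by (auto simp: HR_precision_def HR_Theta_sym[OF assms, of a k b]
        intro!: sum.cong HR_Theta_sym[OF assms])
  then show ?thesis by (simp add: transpose_def vec_eq_iff)
qed

lemma HR_precision_sym:
  assumes "HR_parameter_matrix \<Gamma>"
  shows "HR_precision \<Gamma> k $ a $ b = HR_precision \<Gamma> k $ b $ a"
  using arg_cong[OF transpose_HR_precision[OF assms, of k], of "\<lambda>A. A $ a $ b"]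
  by (simp add: transpose_def)

lemma HR_precision_column_sum:
  "(\<Sum>a\<in>UNIV. HR_precision \<Gamma> k $ a $ b) = 0"
proof -
  have "(\<Sum>a\<in>UNIV. HR_precision \<Gamma> k $ a $ b)
      = HR_precision \<Gamma> k $ k $ b + (\<Sum>a\<in>UNIV - {k}. HR_precision \<Gamma> k $ a $ b)"
    by (simp add: sum.remove)
  also have "\<dots> = 0"
    by (cases "b = k") (simp_all add: HR_precision_def sum_negf)
  finally show ?thesis .
qed

lemma HR_precision_row_sum:
  assumes "HR_parameter_matrix \<Gamma>"
  shows "(\<Sum>b\<in>UNIV. HR_precision \<Gamma> k $ a $ b) = 0"
  by (subst HR_precision_sym[OF assms]) (rule HR_precision_column_sum)

text \<open>Write \<Gamma> through \<Sigma> and the entries in row and column \<open>k\<close>: the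
  zero row sums kill one of these two terms, and the other depends on the row \<open>a\<close> only.
  The value of \<open>v\<close> is irrelevant, since a factor with zero column sums annihilates
  it.\<close>

lemma HR_precision_mult:
  fixes \<Gamma> :: "real^'n^'n"
  assumes \<Gamma>: "HR_parameter_matrix \<Gamma>"
  shows "\<exists>v. \<forall>a c. (\<Sum>b\<in>UNIV. HR_precision \<Gamma> k $ a $ b * \<Gamma> $ b $ c) = v a - (if a = c then 2 else 0)"
proof -
  let ?T = "\<lambda>a b. HR_precision \<Gamma> k $ a $ b" and ?S = "HR_Sigma \<Gamma> k"
  have Skc: "?S k c = 0" and Sck: "?S c k = 0" for c
    using HR_parameter_matrix_diag[OF \<Gamma>] HR_parameter_matrix_sym[OF \<Gamma>, of k c]
    by (simp_all add: HR_Sigma_def)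
  have TS0: "(\<Sum>b\<in>UNIV. ?T a b * ?S b c) = (\<Sum>b\<in>UNIV - {k}. ?T a b * ?S b c)" for a c
    by (intro sum.mono_neutral_right) (auto simp: Skc)
  have TS1: "(\<Sum>b\<in>UNIV. ?T a b * ?S b c) = (if a = c then 1 else 0)" if "a \<noteq> k" "c \<noteq> k" for a c
    using HR_Theta_inverse(2)[OF \<Gamma> that] that unfolding TS0
    by (simp add: HR_precision_def)
  \<comment> \<open>Row \<open>k\<close> is minus the sum of the other rows, whose products with
    \<Sigma> are rows of the identity.\<close>
  have TS2: "(\<Sum>b\<in>UNIV. ?T k b * ?S b c) = - 1" if "c \<noteq> k" for c
  proof -
    have "(\<Sum>b\<in>UNIV. ?T k b * ?S b c) = (\<Sum>b\<in>UNIV. (- (\<Sum>a\<in>UNIV - {k}. ?T a b)) * ?S b c)"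
    proof (intro sum.cong refl)
      fix b
      have "?T k b + (\<Sum>a\<in>UNIV - {k}. ?T a b) = 0"
        using HR_precision_column_sum[of \<Gamma> k b] by (simp add: sum.remove[of UNIV k])
      then have "?T k b = - (\<Sum>a\<in>UNIV - {k}. ?T a b)" by simp
      then show "?T k b * ?S b c = (- (\<Sum>a\<in>UNIV - {k}. ?T a b)) * ?S b c" by simp
    qed
    also have "\<dots> = - (\<Sum>a\<in>UNIV - {k}. \<Sum>b\<in>UNIV. ?T a b * ?S b c)"
      by (subst sum.swap) (simp add: sum_distrib_right sum_negf)
    also have "\<dots> = - (\<Sum>a\<in>UNIV - {k}. if a = c then 1 else 0)"
      using that by (simp add: TS1)
    finally show ?thesis using that by simp
  qed
  have TS: "(\<Sum>b\<in>UNIV. ?T a b * ?S b c) = (if a = c then 1 else 0) - (if a = k then 1 else 0)" for a c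
    using TS1[of a c] TS2[of c] by (cases "c = k"; cases "a = k") (auto simp: Sck)
  have "(\<Sum>b\<in>UNIV. ?T a b * \<Gamma> $ b $ c)
      = ((\<Sum>b\<in>UNIV. ?T a b * \<Gamma> $ b $ k) + (if a = k then 2 else 0)) - (if a = c then 2 else 0)" for a c
  proof -
    have "2 * (\<Sum>b\<in>UNIV. ?T a b * ?S b c)
      = (\<Sum>b\<in>UNIV. ?T a b * (\<Gamma> $ b $ k + \<Gamma> $ c $ k - \<Gamma> $ b $ c))"
      by (simp add: sum_distrib_left HR_Sigma_def)
    also have "\<dots> = (\<Sum>b\<in>UNIV. ?T a b * \<Gamma> $ b $ k) + (\<Sum>b\<in>UNIV. ?T a b) * \<Gamma> $ c $ k
        - (\<Sum>b\<in>UNIV. ?T a b * \<Gamma> $ b $ c)"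
      by (simp add: sum_distrib_right sum.distrib sum_subtractf distrib_left right_diff_distrib)
    finally have "2 * (\<Sum>b\<in>UNIV. ?T a b * ?S b c)
      = (\<Sum>b\<in>UNIV. ?T a b * \<Gamma> $ b $ k) + (\<Sum>b\<in>UNIV. ?T a b) * \<Gamma> $ c $ k
        - (\<Sum>b\<in>UNIV. ?T a b * \<Gamma> $ b $ c)" .
    then show ?thesis by (auto simp: TS HR_precision_row_sum[OF \<Gamma>])
  qed
  then show ?thesis
    by (intro exI[of _ "\<lambda>a. (\<Sum>b\<in>UNIV. ?T a b * \<Gamma> $ b $ k) + (if a = k then 2 else 0)"]) blast
qed

text \<open>
  Both matrices act as a generalised inverse of \<open>- \<Gamma> / 2\<close> on vectors with zero sum, so the
  product of \<open>T\<close>, \<open>- \<Gamma> / 2\<close> and \<open>T'\<close> can be evaluated to either of them.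
\<close>

lemma HR_precision_independent:
  fixes \<Gamma> :: "real^'n^'n"
  assumes \<Gamma>: "HR_parameter_matrix \<Gamma>"
  shows "HR_precision \<Gamma> k = HR_precision \<Gamma> k'"
proof -
  let ?T = "HR_precision \<Gamma> k" and ?T' = "HR_precision \<Gamma> k'"
  note \<Gamma>sym = HR_parameter_matrix_sym[OF \<Gamma>]
  obtain v where v: "(\<Sum>b\<in>UNIV. ?T $ a $ b * \<Gamma> $ b $ c) = v a - (if a = c then 2 else 0)" for a c
    using HR_precision_mult[OF \<Gamma>] by metis
  obtain w where w: "(\<Sum>b\<in>UNIV. ?T' $ a $ b * \<Gamma> $ b $ c) = w a - (if a = c then 2 else 0)" for a c
    using HR_precision_mult[OF \<Gamma>] by metis
  have w': "(\<Sum>c\<in>UNIV. \<Gamma> $ b $ c * ?T' $ c $ d) = w d - (if b = d then 2 else 0)" for b d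
    using w[of d b] by (simp add: HR_precision_sym[OF \<Gamma>, of k' _ d] \<Gamma>sym[of b] mult.commute eq_commute)
  have "?T $ a $ d = ?T' $ a $ d" for a d
  proof -
    have "(\<Sum>c\<in>UNIV. (\<Sum>b\<in>UNIV. ?T $ a $ b * \<Gamma> $ b $ c) * ?T' $ c $ d)
        = v a * (\<Sum>c\<in>UNIV. ?T' $ c $ d) - 2 * ?T' $ a $ d"
      by (simp add: v left_diff_distrib sum_subtractf sum_distrib_left
          if_distrib[of "\<lambda>x. x * _"] cong: if_cong)
    moreover have "(\<Sum>b\<in>UNIV. ?T $ a $ b * (\<Sum>c\<in>UNIV. \<Gamma> $ b $ c * ?T' $ c $ d))
        = w d * (\<Sum>b\<in>UNIV. ?T $ a $ b) - 2 * ?T $ a $ d"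
      by (simp add: w' right_diff_distrib sum_subtractf sum_distrib_left mult.commute[of _ "w d"]
          if_distrib[of "\<lambda>x. _ * x"] cong: if_cong)
    moreover have "(\<Sum>c\<in>UNIV. (\<Sum>b\<in>UNIV. ?T $ a $ b * \<Gamma> $ b $ c) * ?T' $ c $ d)
        = (\<Sum>b\<in>UNIV. ?T $ a $ b * (\<Sum>c\<in>UNIV. \<Gamma> $ b $ c * ?T' $ c $ d))"
      by (simp add: sum_distrib_left sum_distrib_right mult.assoc) (rule sum.swap)
    ultimately show ?thesis
      by (simp add: HR_precision_column_sum HR_precision_row_sum[OF \<Gamma>])
  qed
  then show ?thesis by (simp add: vec_eq_iff)
qed


section \<open>Conditional independence in terms of densities\<close>

text \<open>Unnormalised on purpose: the conditional probability of \<open>C\<close> is the quotient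
  by the mass of the whole space, which is well behaved only almost everywhere.\<close>

definition fibre_mass :: "'r measure \<Rightarrow> ('w \<times> 'r \<Rightarrow> ennreal) \<Rightarrow> 'r set \<Rightarrow> 'w \<Rightarrow> ennreal" where
  "fibre_mass R \<phi> C w = (\<integral>\<^sup>+t. \<phi> (w, t) * indicator C t \<partial>R)"

lemma fibre_mass_le_space: "fibre_mass R \<phi> C w \<le> fibre_mass R \<phi> (space R) w"
  unfolding fibre_mass_def by (intro nn_integral_mono) (auto split: split_indicator)

lemma fibre_mass_less_top:
  "fibre_mass R \<phi> (space R) w < top \<Longrightarrow> fibre_mass R \<phi> C w < top"
  by (rule le_less_trans[OF fibre_mass_le_space])

text \<open>The joint law is given by iterated integrals against all measurable functions. This form
  asks for sigma-finiteness of \<open>R\<close> only and leaves \<open>L\<close> arbitrary.\<close>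

locale joint_density = prob_space N for N :: "'a measure" +
  fixes L :: "'w measure" and R :: "'r measure" and W T and \<phi> :: "'w \<times> 'r \<Rightarrow> ennreal"
  assumes sigma_finite_R: "sigma_finite_measure R"
    and W [measurable]: "W \<in> N \<rightarrow>\<^sub>M L" and T [measurable]: "T \<in> N \<rightarrow>\<^sub>M R"
    and \<phi> [measurable]: "\<phi> \<in> borel_measurable (L \<Otimes>\<^sub>M R)"
    and law: "h \<in> borel_measurable (L \<Otimes>\<^sub>M R) \<Longrightarrow>
      (\<integral>\<^sup>+\<omega>. h (W \<omega>, T \<omega>) \<partial>N) = (\<integral>\<^sup>+w. \<integral>\<^sup>+t. \<phi> (w, t) * h (w, t) \<partial>R \<partial>L)"
begin

lemma measurable_fibre_mass [measurable]:
  assumes [measurable]: "C \<in> sets R"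
  shows "fibre_mass R \<phi> C \<in> borel_measurable L"
proof -
  interpret R: sigma_finite_measure R by (rule sigma_finite_R)
  show ?thesis unfolding fibre_mass_def by measurable
qed

lemma nn_integral_mult_indicator:
  assumes [measurable]: "C \<in> sets R" "g \<in> borel_measurable L"
  shows "(\<integral>\<^sup>+\<omega>. g (W \<omega>) * indicator C (T \<omega>) \<partial>N) = (\<integral>\<^sup>+w. g w * fibre_mass R \<phi> C w \<partial>L)"
proof -
  have "(\<integral>\<^sup>+\<omega>. g (W \<omega>) * indicator C (T \<omega>) \<partial>N)
      = (\<integral>\<^sup>+w. \<integral>\<^sup>+t. \<phi> (w, t) * (g w * indicator C t) \<partial>R \<partial>L)"
    using law[of "\<lambda>(w, t). g w * indicator C t"] by simp
  also have "\<dots> = (\<integral>\<^sup>+w. g w * fibre_mass R \<phi> C w \<partial>L)"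
    unfolding fibre_mass_def
    by (intro nn_integral_cong, subst nn_integral_cmult[symmetric]) (auto simp: ac_simps)
  finally show ?thesis .
qed

lemma nn_integral_W:
  assumes [measurable]: "g \<in> borel_measurable L"
  shows "(\<integral>\<^sup>+\<omega>. g (W \<omega>) \<partial>N) = (\<integral>\<^sup>+w. g w * fibre_mass R \<phi> (space R) w \<partial>L)"
proof -
  have "(\<integral>\<^sup>+\<omega>. g (W \<omega>) \<partial>N) = (\<integral>\<^sup>+\<omega>. g (W \<omega>) * indicator (space R) (T \<omega>) \<partial>N)"
    using measurable_space[OF T] by (intro nn_integral_cong) auto
  then show ?thesis by (simp add: nn_integral_mult_indicator)
qed

lemma AE_fibre_mass_finite: "AE w in L. fibre_mass R \<phi> (space R) w \<noteq> \<infinity>"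
proof (rule nn_integral_PInf_AE)
  show "(\<integral>\<^sup>+w. fibre_mass R \<phi> (space R) w \<partial>L) \<noteq> \<infinity>"
    using nn_integral_W[of "\<lambda>_. 1"] by (simp add: emeasure_space_1)
qed simp

text \<open>The total fibre mass is the density of \<open>W\<close>. Its zero set therefore carries
  no mass under the law of \<open>W\<close>, and the set where it is infinite is null for
  \<open>L\<close>.\<close>

lemma AE_fibre_mass:
  "AE \<omega> in N. 0 < fibre_mass R \<phi> (space R) (W \<omega>) \<and> fibre_mass R \<phi> (space R) (W \<omega>) < top"
proof -
  let ?J = "fibre_mass R \<phi> (space R)"
  let ?g = "\<lambda>w. indicator {w \<in> space L. ?J w = 0 \<or> ?J w = top} w :: ennreal"
  have "(\<integral>\<^sup>+\<omega>. ?g (W \<omega>) \<partial>N) = (\<integral>\<^sup>+w. ?g w * ?J w \<partial>L)"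
    by (rule nn_integral_W) simp
  also have "\<dots> = 0"
    using AE_fibre_mass_finite
    by (subst nn_integral_0_iff_AE) (auto elim!: eventually_mono split: split_indicator)
  finally have "AE \<omega> in N. ?g (W \<omega>) = 0"
    by (subst (asm) nn_integral_0_iff_AE) auto
  then show ?thesis
  proof (rule AE_mp, intro AE_I2 impI)
    fix \<omega> assume "\<omega> \<in> space N" "?g (W \<omega>) = 0"
    then show "0 < ?J (W \<omega>) \<and> ?J (W \<omega>) < top"
      using measurable_space[OF W] by (auto simp: zero_less_iff_neq_zero less_top split: split_indicator_asm)
  qed
qed

text \<open>Bayes' formula. Conditional expectations are characterised by their integrals over the
  preimages under \<open>W\<close>; there the denominator cancels against the density of
  \<open>W\<close>.\<close>

lemma real_cond_exp_indicator:
  assumes C [measurable]: "C \<in> sets R"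
  shows "AE \<omega> in N. real_cond_exp N (vimage_algebra (space N) W L) (indicator (T -` C)) \<omega>
      = enn2real (fibre_mass R \<phi> C (W \<omega>) / fibre_mass R \<phi> (space R) (W \<omega>))"
proof -
  let ?F = "vimage_algebra (space N) W L"
  let ?J = "fibre_mass R \<phi>"
  let ?\<psi> = "\<lambda>w. ?J C w / ?J (space R) w"
  have W_space: "W \<in> space N \<rightarrow> space L"
    using measurable_space[OF W] by auto
  have setsF: "sets ?F = {W -` D \<inter> space N |D. D \<in> sets L}"
    by (rule sets_vimage_algebra2[OF W_space])
  have sub: "subalgebra N ?F"
    unfolding subalgebra_def setsF using measurable_sets[OF W] by auto
  interpret F: sigma_finite_subalgebra N ?F
    by (rule finite_measure_subalgebra_is_sigma_finite) (unfold_locales, rule sub)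
  \<comment> \<open>In \<open>ennreal\<close> both \<open>0 / 0\<close> and
    \<open>x / \<infinity>\<close> are 0, so the bound needs no exceptional set.\<close>
  have le1: "?\<psi> w \<le> 1" for w
  proof (cases "?J (space R) w = 0 \<or> ?J (space R) w = top")
    case True
    then show ?thesis using fibre_mass_le_space[of R \<phi> C w] by auto
  next
    case False
    have "?\<psi> w \<le> ?J (space R) w / ?J (space R) w"
      by (rule divide_right_mono_ennreal[OF fibre_mass_le_space])
    then show ?thesis using False by (simp add: less_top)
  qed
  have WF [measurable]: "W \<in> ?F \<rightarrow>\<^sub>M L"
    by (rule measurable_vimage_algebra1) (rule W_space)
  have meas1: "indicator (T -` C) \<in> borel_measurable N"
  proof -
    have "T -` C \<inter> space N \<in> sets N" by measurable
    then show ?thesis by (simp add: borel_measurable_indicator_iff)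
  qed
  have eqnn: "(\<integral>\<^sup>+\<omega>. indicator D (W \<omega>) * ?\<psi> (W \<omega>) \<partial>N) = (\<integral>\<^sup>+\<omega>. indicator D (W \<omega>) * indicator C (T \<omega>) \<partial>N)"
    if [measurable]: "D \<in> sets L" for D
  proof -
    have "(\<integral>\<^sup>+\<omega>. indicator D (W \<omega>) * ?\<psi> (W \<omega>) \<partial>N)
        = (\<integral>\<^sup>+w. indicator D w * ?\<psi> w * ?J (space R) w \<partial>L)"
      by (rule nn_integral_W) simp
    also have "\<dots> = (\<integral>\<^sup>+w. indicator D w * ?J C w \<partial>L)"
    proof (rule nn_integral_cong_AE, use AE_fibre_mass_finite in eventually_elim)
      fix w assume fin: "?J (space R) w \<noteq> \<infinity>"
      \<comment> \<open>A vanishing total mass forces the mass of \<open>C\<close> to vanish, so the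
        cancellation survives a zero denominator.\<close>
      have "?\<psi> w * ?J (space R) w = ?J C w"
      proof (cases "?J (space R) w = 0")
        case True
        then show ?thesis using fibre_mass_le_space[of R \<phi> C w] by simp
      next
        case False
        then show ?thesis using fin
          by (simp add: ennreal_divide_times mult_divide_eq_ennreal ennreal_times_divide)
      qed
      then show "indicator D w * ?\<psi> w * ?J (space R) w = indicator D w * ?J C w"
        by (simp add: mult.assoc)
    qed
    also have "\<dots> = (\<integral>\<^sup>+\<omega>. indicator D (W \<omega>) * indicator C (T \<omega>) \<partial>N)"
      by (rule nn_integral_mult_indicator[symmetric]) auto
    finally show ?thesis .
  qed
  show ?thesis
  proof (rule F.real_cond_exp_charact)
    show int1: "integrable N (indicator (T -` C) :: 'a \<Rightarrow> real)"
      by (rule integrable_const_bound[of _ 1]) (use meas1 in auto)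
    have le1r: "enn2real (?\<psi> w) \<le> 1" for w
      using enn2real_mono[OF le1[of w]] by simp
    show int2: "integrable N (\<lambda>\<omega>. enn2real (?\<psi> (W \<omega>)))"
      by (rule integrable_const_bound[of _ 1]) (use le1r in auto)
    show "(\<lambda>\<omega>. enn2real (?\<psi> (W \<omega>))) \<in> borel_measurable ?F"
      by measurable
    fix A assume "A \<in> sets ?F"
    then obtain D where D [measurable]: "D \<in> sets L" and A: "A = W -` D \<inter> space N"
      unfolding setsF by blast
    have e1: "(\<integral>x\<in>A. indicator (T -` C) x \<partial>N)
        = enn2real (\<integral>\<^sup>+\<omega>. indicator D (W \<omega>) * indicator C (T \<omega>) \<partial>N)"
      unfolding set_lebesgue_integral_def
      by (subst integral_eq_nn_integral)
        (use meas1 A in \<open>auto intro!: arg_cong[of _ _ enn2real] nn_integral_cong split: split_indicator\<close>)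
    have e2: "(\<integral>x\<in>A. enn2real (?\<psi> (W x)) \<partial>N)
        = enn2real (\<integral>\<^sup>+\<omega>. indicator D (W \<omega>) * ?\<psi> (W \<omega>) \<partial>N)"
    proof -
      have fin: "?\<psi> w < top" for w using le1[of w] by (simp add: le_less_trans)
      show ?thesis
        unfolding set_lebesgue_integral_def
        by (subst integral_eq_nn_integral)
          (use A fin in \<open>auto intro!: arg_cong[of _ _ enn2real] nn_integral_cong split: split_indicator\<close>)
    qed
    show "(\<integral>x\<in>A. indicator (T -` C) x \<partial>N) = (\<integral>x\<in>A. enn2real (?\<psi> (W x)) \<partial>N)"
      unfolding e1 e2 eqnn[OF D] ..
  qed
qed

end

section \<open>Rectangle masses of a planar density with an interaction factor\<close>

lemma nn_integral_product_lborel: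
  fixes f g :: "real \<Rightarrow> ennreal"
  assumes [measurable]: "f \<in> borel_measurable borel" "g \<in> borel_measurable borel"
  shows "(\<integral>\<^sup>+t. f (fst t) * g (snd t) \<partial>(lborel \<Otimes>\<^sub>M lborel)) = (\<integral>\<^sup>+x. f x \<partial>lborel) * (\<integral>\<^sup>+z. g z \<partial>lborel)"
proof -
  have "(\<integral>\<^sup>+t. f (fst t) * g (snd t) \<partial>(lborel \<Otimes>\<^sub>M lborel)) = (\<integral>\<^sup>+x. \<integral>\<^sup>+z. f x * g z \<partial>lborel \<partial>lborel)"
    by (subst lborel.nn_integral_fst[symmetric]) simp_all
  also have "\<dots> = (\<integral>\<^sup>+x. f x * (\<integral>\<^sup>+z. g z \<partial>lborel) \<partial>lborel)"
    by (intro nn_integral_cong nn_integral_cmult) simp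
  also have "\<dots> = (\<integral>\<^sup>+x. f x \<partial>lborel) * (\<integral>\<^sup>+z. g z \<partial>lborel)"
    by (rule nn_integral_multc) simp
  finally show ?thesis .
qed

text \<open>In the application \<kappa> is the density on one fibre, \<open>f\<close> and
  \<open>g\<close> are its restrictions to the two lines through the reference point,
  \<open>q\<close> is its value there, and \<open>e\<close> is the interaction factor. Dividing by
  \<open>q\<close> is avoided until \<open>q\<close> is known to be nonzero and finite.\<close>

context
  fixes \<kappa> :: "real \<times> real \<Rightarrow> ennreal" and f g :: "real \<Rightarrow> ennreal" and q :: ennreal
    and e :: "real \<Rightarrow> real \<Rightarrow> real"
  assumes \<kappa> [measurable]: "\<kappa> \<in> borel_measurable (lborel \<Otimes>\<^sub>M lborel)"
    and f [measurable]: "f \<in> borel_measurable borel" and g [measurable]: "g \<in> borel_measurable borel"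
    and factor: "\<And>x z. \<kappa> (x, z) * q = f x * g z * ennreal (e x z)"
begin

private abbreviation mass where
  "mass A B \<equiv> \<integral>\<^sup>+t. \<kappa> t * indicator (A \<times> B) t \<partial>(lborel \<Otimes>\<^sub>M lborel)"

lemma mass_lower:
  assumes [measurable]: "A \<in> sets borel" "B \<in> sets borel"
    and le: "\<And>x z. x \<in> A \<Longrightarrow> z \<in> B \<Longrightarrow> \<delta> \<le> e x z"
  shows "ennreal \<delta> * ((\<integral>\<^sup>+x. f x * indicator A x \<partial>lborel) * (\<integral>\<^sup>+z. g z * indicator B z \<partial>lborel)) \<le> mass A B * q"
proof -
  have "ennreal \<delta> * ((\<integral>\<^sup>+x. f x * indicator A x \<partial>lborel) * (\<integral>\<^sup>+z. g z * indicator B z \<partial>lborel))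
      = (\<integral>\<^sup>+t. ennreal \<delta> * ((f (fst t) * indicator A (fst t)) * (g (snd t) * indicator B (snd t))) \<partial>(lborel \<Otimes>\<^sub>M lborel))"
    by (subst nn_integral_cmult) (simp_all add: nn_integral_product_lborel[of "\<lambda>x. f x * indicator A x" "\<lambda>z. g z * indicator B z"])
  also have "\<dots> \<le> (\<integral>\<^sup>+t. \<kappa> t * indicator (A \<times> B) t * q \<partial>(lborel \<Otimes>\<^sub>M lborel))"
  proof (intro nn_integral_mono)
    fix t :: "real \<times> real"
    obtain x z where t: "t = (x, z)" by (cases t)
    show "ennreal \<delta> * ((f (fst t) * indicator A (fst t)) * (g (snd t) * indicator B (snd t)))
        \<le> \<kappa> t * indicator (A \<times> B) t * q"
      unfolding t using factor[of x z] mult_left_mono[OF ennreal_leI[OF le], of x z "f x * g z"]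
      by (auto simp: indicator_def ac_simps)
  qed
  also have "\<dots> = mass A B * q"
    by (rule nn_integral_multc) simp
  finally show ?thesis .
qed

lemma mass_upper:
  assumes [measurable]: "A \<in> sets borel" "B \<in> sets borel"
    and le: "\<And>x z. x \<in> A \<Longrightarrow> z \<in> B \<Longrightarrow> e x z \<le> \<delta>"
  shows "mass A B * q \<le> ennreal \<delta> * ((\<integral>\<^sup>+x. f x * indicator A x \<partial>lborel) * (\<integral>\<^sup>+z. g z * indicator B z \<partial>lborel))"
proof -
  have "mass A B * q = (\<integral>\<^sup>+t. \<kappa> t * indicator (A \<times> B) t * q \<partial>(lborel \<Otimes>\<^sub>M lborel))"
    by (rule nn_integral_multc[symmetric]) simp
  also have "\<dots> \<le> (\<integral>\<^sup>+t. ennreal \<delta> * ((f (fst t) * indicator A (fst t)) * (g (snd t) * indicator B (snd t))) \<partial>(lborel \<Otimes>\<^sub>M lborel))"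
  proof (intro nn_integral_mono)
    fix t :: "real \<times> real"
    obtain x z where t: "t = (x, z)" by (cases t)
    show "\<kappa> t * indicator (A \<times> B) t * q
        \<le> ennreal \<delta> * ((f (fst t) * indicator A (fst t)) * (g (snd t) * indicator B (snd t)))"
      unfolding t using factor[of x z] mult_left_mono[OF ennreal_leI[OF le], of x z "f x * g z"]
      by (auto simp: indicator_def ac_simps)
  qed
  also have "\<dots> = ennreal \<delta> * ((\<integral>\<^sup>+x. f x * indicator A x \<partial>lborel) * (\<integral>\<^sup>+z. g z * indicator B z \<partial>lborel))"
    by (subst nn_integral_cmult) (simp_all add: nn_integral_product_lborel[of "\<lambda>x. f x * indicator A x" "\<lambda>z. g z * indicator B z"])
  finally show ?thesis .
qed

text \<open>Without interaction the bounds of \<open>mass_lower\<close> and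
  \<open>mass_upper\<close> meet, so every rectangle mass times \<open>q\<close> splits into two
  one-dimensional integrals; \<open>q * q\<close> then cancels.\<close>

lemma mass_product:
  assumes q: "q \<noteq> 0" "q \<noteq> top" and e: "\<And>x z. e x z = 1"
    and AB: "A \<in> sets borel" "B \<in> sets borel"
  shows "mass A B * mass UNIV UNIV = mass A UNIV * mass UNIV B"
proof -
  have m: "mass C D * q = (\<integral>\<^sup>+x. f x * indicator C x \<partial>lborel) * (\<integral>\<^sup>+z. g z * indicator D z \<partial>lborel)"
    if "C \<in> sets borel" "D \<in> sets borel" for C D
    using mass_lower[OF that, of 1] mass_upper[OF that, of 1] e by (intro antisym) auto
  have borel_UNIV: "UNIV \<in> sets (borel :: real measure)" by simp
  have "(mass A B * q) * (mass UNIV UNIV * q) = (mass A UNIV * q) * (mass UNIV B * q)"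
    unfolding m[OF AB] m[OF borel_UNIV borel_UNIV] m[OF AB(1) borel_UNIV] m[OF borel_UNIV AB(2)]
    by (simp only: ac_simps)
  then have "(q * q) * (mass A B * mass UNIV UNIV) = (q * q) * (mass A UNIV * mass UNIV B)"
    by (simp add: ac_simps)
  moreover have "q * q \<noteq> 0" "q * q \<noteq> top" using q by (auto simp: ennreal_mult_eq_top_iff)
  ultimately show ?thesis unfolding ennreal_mult_cancel_left by blast
qed

text \<open>After multiplication by \<open>q * q\<close> the left side is at least
  \<open>\<delta> * \<delta> * P\<close> and the right side at most \<open>P\<close>, where
  \<open>P\<close> is the product of the four one-dimensional integrals. Equality is then impossible
  for positive finite \<open>P\<close>.\<close>

lemma mass_cross_ratio:
  assumes q: "q \<noteq> 0" "q \<noteq> top" and \<delta>: "1 < \<delta>"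
    and sets: "A \<in> sets borel" "B \<in> sets borel" "A' \<in> sets borel" "B' \<in> sets borel"
    and large: "\<And>x z. x \<in> A \<and> z \<in> B \<or> x \<in> A' \<and> z \<in> B' \<Longrightarrow> \<delta> \<le> e x z"
    and small: "\<And>x z. x \<in> A \<and> z \<in> B' \<or> x \<in> A' \<and> z \<in> B \<Longrightarrow> e x z \<le> 1"
    and pos: "(\<integral>\<^sup>+x. f x * indicator A x \<partial>lborel) \<noteq> 0" "(\<integral>\<^sup>+x. f x * indicator A' x \<partial>lborel) \<noteq> 0"
      "(\<integral>\<^sup>+x. g x * indicator B x \<partial>lborel) \<noteq> 0" "(\<integral>\<^sup>+x. g x * indicator B' x \<partial>lborel) \<noteq> 0"
    and fin: "mass A B < top" "mass A' B' < top"
  shows "mass A B * mass A' B' \<noteq> mass A B' * mass A' B"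
proof
  assume eq: "mass A B * mass A' B' = mass A B' * mass A' B"
  let ?f = "\<lambda>A. \<integral>\<^sup>+x. f x * indicator A x \<partial>lborel" and ?g = "\<lambda>A. \<integral>\<^sup>+x. g x * indicator A x \<partial>lborel"
  define P where "P = (?f A * ?g B) * (?f A' * ?g B')"
  have lo: "ennreal \<delta> * (?f A * ?g B) \<le> mass A B * q" "ennreal \<delta> * (?f A' * ?g B') \<le> mass A' B' * q"
    by (rule mass_lower; use sets large in auto)+
  have hi: "mass A B' * q \<le> ?f A * ?g B'" "mass A' B * q \<le> ?f A' * ?g B"
    using mass_upper[OF sets(1,4), of 1] mass_upper[OF sets(3,2), of 1] small by auto
  \<comment> \<open>Finiteness of \<open>P\<close> is inherited, through the lower bounds, from the
    two rectangles with large interaction.\<close>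
  have "ennreal \<delta> * (?f A * ?g B) < top" "ennreal \<delta> * (?f A' * ?g B') < top"
    by (rule le_less_trans[OF lo(1)], use fin q in \<open>simp add: ennreal_mult_less_top less_top\<close>)
      (rule le_less_trans[OF lo(2)], use fin q in \<open>simp add: ennreal_mult_less_top less_top\<close>)
  then have "?f A * ?g B < top" "?f A' * ?g B' < top"
    using \<delta> by (auto simp: ennreal_mult_less_top)
  then have "P < top"
    unfolding P_def by (rule ennreal_mult_less_top[THEN iffD2, OF disjI2, OF disjI2, OF conjI])
  moreover have "P \<noteq> 0" using pos by (simp add: P_def)
  moreover have "ennreal \<delta> * ennreal \<delta> * P \<le> P"
  proof -
    have "ennreal \<delta> * ennreal \<delta> * P = (ennreal \<delta> * (?f A * ?g B)) * (ennreal \<delta> * (?f A' * ?g B'))"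
      by (simp add: P_def ac_simps)
    also have "\<dots> \<le> (mass A B * q) * (mass A' B' * q)"
      by (intro mult_mono lo) auto
    also have "\<dots> = (mass A B * mass A' B') * (q * q)"
      by (simp only: ac_simps)
    also have "\<dots> = (mass A B' * q) * (mass A' B * q)"
      unfolding eq by (simp only: ac_simps)
    also have "\<dots> \<le> (?f A * ?g B') * (?f A' * ?g B)"
      by (intro mult_mono hi) auto
    also have "\<dots> = P" by (simp only: P_def ac_simps)
    finally show ?thesis .
  qed
  ultimately obtain p where p: "0 < p" "P = ennreal p" "ennreal (\<delta> * \<delta> * p) \<le> ennreal p"
    using \<delta> by (cases P) (auto simp: ennreal_mult less_le)
  then have "\<delta> * \<delta> * p \<le> 1 * p" by (simp add: ennreal_le_iff)
  then have "\<delta> * \<delta> \<le> 1" using p(1) by (simp only: mult_le_cancel_right_pos)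
  moreover have "1 * 1 < \<delta> * \<delta>" using \<delta> by (intro mult_strict_mono) auto
  ultimately show False by simp
qed

end

lemma enn2real_divide_mult_eq_iff:
  fixes a b c t :: ennreal
  assumes "a \<le> t" "b \<le> t" "c \<le> t" "0 < t" "t < top"
  shows "enn2real (a / t) = enn2real (b / t) * enn2real (c / t) \<longleftrightarrow> a * t = b * c"
proof -
  have "a < top" "b < top" "c < top" using assms le_less_trans by blast+
  then obtain a' b' c' t' where "a = ennreal a'" "b = ennreal b'" "c = ennreal c'" "t = ennreal t'"
    and nonneg: "0 \<le> a'" "0 \<le> b'" "0 \<le> c'" "0 \<le> t'"
    using \<open>t < top\<close> by (cases a; cases b; cases c; cases t) auto
  moreover from this have "0 < t'" using \<open>0 < t\<close> by (cases "t' = 0") auto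
  ultimately show ?thesis
    by (simp add: divide_ennreal field_simps flip: ennreal_mult)
qed

text \<open>The three conditional probabilities share a denominator that is almost everywhere
  positive and finite, so it can be cleared.\<close>

lemma cond_indep_var_iff_fibre_mass:
  fixes X Z :: "'a \<Rightarrow> real"
  assumes "joint_density N L (lborel \<Otimes>\<^sub>M lborel) W (\<lambda>\<omega>. (X \<omega>, Z \<omega>)) \<phi>"
  defines "J \<equiv> \<lambda>A B. fibre_mass (lborel \<Otimes>\<^sub>M lborel) \<phi> (A \<times> B)"
  shows "cond_indep_var N borel X borel Z L W \<longleftrightarrow>
    (\<forall>A\<in>sets borel. \<forall>B\<in>sets borel. AE \<omega> in N.
       J A B (W \<omega>) * J UNIV UNIV (W \<omega>) = J A UNIV (W \<omega>) * J UNIV B (W \<omega>))"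
proof -
  interpret joint_density N L "lborel \<Otimes>\<^sub>M lborel" W "\<lambda>\<omega>. (X \<omega>, Z \<omega>)" \<phi> by fact
  let ?F = "vimage_algebra (space N) W L"
  have sp: "space (lborel \<Otimes>\<^sub>M lborel) = (UNIV \<times> UNIV :: (real \<times> real) set)"
    by (simp add: space_pair_measure)
  have "(AE \<omega> in N. real_cond_exp N ?F (indicator (X -` A \<inter> Z -` B)) \<omega> =
      real_cond_exp N ?F (indicator (X -` A)) \<omega> * real_cond_exp N ?F (indicator (Z -` B)) \<omega>) \<longleftrightarrow>
    (AE \<omega> in N. J A B (W \<omega>) * J UNIV UNIV (W \<omega>) = J A UNIV (W \<omega>) * J UNIV B (W \<omega>))"
    if AB [measurable]: "A \<in> sets borel" "B \<in> sets borel" for A B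
  proof (rule eventually_subst)
    have s: "A \<times> B \<in> sets (lborel \<Otimes>\<^sub>M lborel)" "A \<times> UNIV \<in> sets (lborel \<Otimes>\<^sub>M lborel)"
      "UNIV \<times> B \<in> sets (lborel \<Otimes>\<^sub>M lborel)"
      by (auto intro!: pair_measureI)
    have pre: "(\<lambda>\<omega>. (X \<omega>, Z \<omega>)) -` (A \<times> B) = X -` A \<inter> Z -` B"
      "(\<lambda>\<omega>. (X \<omega>, Z \<omega>)) -` (A \<times> UNIV) = X -` A" "(\<lambda>\<omega>. (X \<omega>, Z \<omega>)) -` (UNIV \<times> B) = Z -` B"
      by auto
    show "AE \<omega> in N. (real_cond_exp N ?F (indicator (X -` A \<inter> Z -` B)) \<omega> =
      real_cond_exp N ?F (indicator (X -` A)) \<omega> * real_cond_exp N ?F (indicator (Z -` B)) \<omega>) \<longleftrightarrow>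
      J A B (W \<omega>) * J UNIV UNIV (W \<omega>) = J A UNIV (W \<omega>) * J UNIV B (W \<omega>)"
      using AE_fibre_mass real_cond_exp_indicator[OF s(1)] real_cond_exp_indicator[OF s(2)]
        real_cond_exp_indicator[OF s(3)]
      unfolding pre
    proof eventually_elim
      fix \<omega>
      let ?T = "J UNIV UNIV (W \<omega>)"
      assume pos: "0 < fibre_mass (lborel \<Otimes>\<^sub>M lborel) \<phi> (space (lborel \<Otimes>\<^sub>M lborel)) (W \<omega>)
          \<and> fibre_mass (lborel \<Otimes>\<^sub>M lborel) \<phi> (space (lborel \<Otimes>\<^sub>M lborel)) (W \<omega>) < top"
        and eqs: "real_cond_exp N ?F (indicator (X -` A \<inter> Z -` B)) \<omega> = enn2real
          (fibre_mass (lborel \<Otimes>\<^sub>M lborel) \<phi> (A \<times> B) (W \<omega>)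
            / fibre_mass (lborel \<Otimes>\<^sub>M lborel) \<phi> (space (lborel \<Otimes>\<^sub>M lborel)) (W \<omega>))"
        "real_cond_exp N ?F (indicator (X -` A)) \<omega> = enn2real
          (fibre_mass (lborel \<Otimes>\<^sub>M lborel) \<phi> (A \<times> UNIV) (W \<omega>)
            / fibre_mass (lborel \<Otimes>\<^sub>M lborel) \<phi> (space (lborel \<Otimes>\<^sub>M lborel)) (W \<omega>))"
        "real_cond_exp N ?F (indicator (Z -` B)) \<omega> = enn2real
          (fibre_mass (lborel \<Otimes>\<^sub>M lborel) \<phi> (UNIV \<times> B) (W \<omega>)
            / fibre_mass (lborel \<Otimes>\<^sub>M lborel) \<phi> (space (lborel \<Otimes>\<^sub>M lborel)) (W \<omega>))"
      have le: "J C D (W \<omega>) \<le> ?T" for C D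
        using fibre_mass_le_space[of "lborel \<Otimes>\<^sub>M lborel" \<phi> "C \<times> D" "W \<omega>"] unfolding J_def sp .
      show "(real_cond_exp N ?F (indicator (X -` A \<inter> Z -` B)) \<omega> =
        real_cond_exp N ?F (indicator (X -` A)) \<omega> * real_cond_exp N ?F (indicator (Z -` B)) \<omega>) \<longleftrightarrow>
        J A B (W \<omega>) * ?T = J A UNIV (W \<omega>) * J UNIV B (W \<omega>)"
        using enn2real_divide_mult_eq_iff[OF le le le] pos unfolding eqs sp J_def by blast
    qed
  qed
  then show ?thesis unfolding cond_indep_var_def Let_def by simp
qed

text \<open>Reconciles the \<open>borel\<close> factors of the definition of extremal independence
  with the \<open>lborel\<close> factors needed for integration.\<close>

lemma cond_indep_var_cong_sets:
  assumes "sets N\<^sub>3 = sets N\<^sub>3'"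
  shows "cond_indep_var M N\<^sub>1 X N\<^sub>2 Z N\<^sub>3 W \<longleftrightarrow> cond_indep_var M N\<^sub>1 X N\<^sub>2 Z N\<^sub>3' W"
  unfolding cond_indep_var_def vimage_algebra_def assms ..

lemma nn_integral_pos_on_interval:
  fixes f :: "real \<Rightarrow> ennreal"
  assumes [measurable]: "f \<in> borel_measurable borel" and "a < b"
    and pos: "\<And>x. a < x \<Longrightarrow> x < b \<Longrightarrow> f x \<noteq> 0"
  shows "(\<integral>\<^sup>+x. f x * indicator {a<..<b} x \<partial>lborel) \<noteq> 0"
proof
  assume "(\<integral>\<^sup>+x. f x * indicator {a<..<b} x \<partial>lborel) = 0"
  then have "AE x in lborel. f x * indicator {a<..<b} x = 0"
    by (subst (asm) nn_integral_0_iff_AE) auto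
  then have "AE x in lborel. x \<notin> {a<..<b}"
    by (rule AE_mp) (use pos in \<open>auto intro!: AE_I2\<close>)
  then have "emeasure lborel {a<..<b} = 0"
    by (subst (asm) AE_iff_measurable[of "{a<..<b}"]) auto
  then show False using \<open>a < b\<close> by simp
qed


section \<open>Splitting off two coordinates of Lebesgue measure\<close>

lemma measurable_vec_lambda [measurable]:
  "vec_lambda \<in> (\<Pi>\<^sub>M l\<in>(UNIV :: 'n::finite set). borel) \<rightarrow>\<^sub>M (borel :: (real^'n) measure)"
  by (subst borel_measurable_euclidean_space) (auto simp: Basis_vec_def inner_axis)

lemma measurable_vec_nth [measurable]: "(\<lambda>y::real^'n. y $ l) \<in> borel_measurable borel"
  by (intro borel_measurable_continuous_onI continuous_intros)

text \<open>Lebesgue measure is determined by its values on boxes, and a box pulls back to a product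
  of intervals.\<close>

lemma lborel_eq_distr_PiM:
  "(lborel :: (real^'n) measure) = distr (\<Pi>\<^sub>M l\<in>(UNIV :: 'n set). lborel) borel vec_lambda"
proof (rule lborel_eqI)
  interpret product_sigma_finite "\<lambda>_::'n. lborel :: real measure" ..
  fix l u :: "real^'n" assume le: "\<And>b. b \<in> Basis \<Longrightarrow> l \<bullet> b \<le> u \<bullet> b"
  have le': "l $ i \<le> u $ i" for i
    using le[of "axis i 1"] by (auto simp: Basis_vec_def inner_axis)
  have V: "vec_lambda \<in> (\<Pi>\<^sub>M l\<in>(UNIV :: 'n set). lborel) \<rightarrow>\<^sub>M (borel :: (real^'n) measure)"
    using measurable_vec_lambda by (simp cong: measurable_cong_sets sets_PiM_cong)
  have "vec_lambda -` box l u \<inter> space (\<Pi>\<^sub>M l\<in>(UNIV :: 'n set). lborel)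
      = (\<Pi>\<^sub>E i\<in>UNIV. {l $ i <..< u $ i})"
    by (auto simp: mem_box_cart space_PiM PiE_def Pi_def)
  then have "emeasure (distr (\<Pi>\<^sub>M l\<in>(UNIV :: 'n set). lborel) borel vec_lambda) (box l u)
      = (\<Prod>i\<in>UNIV. ennreal (u $ i - l $ i))"
    using le' by (simp add: emeasure_distr[OF V] emeasure_PiM)
  also have "\<dots> = ennreal (\<Prod>i\<in>UNIV. (u - l) $ i)"
    using le' by (simp add: prod_ennreal)
  also have "(\<Prod>i\<in>UNIV. (u - l) $ i) = (\<Prod>b\<in>Basis. (u - l) \<bullet> b)"
    unfolding Basis_vec_def
    by (simp add: prod.UNION_disjoint axis_eq_axis inner_axis)
  finally show "emeasure (distr (\<Pi>\<^sub>M l\<in>(UNIV :: 'n set). lborel) borel vec_lambda) (box l u)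
      = ennreal (\<Prod>b\<in>Basis. (u - l) \<bullet> b)" .
qed simp

text \<open>A point \<open>w\<close> of the product space over the other coordinates is
  \<open>undefined\<close> at \<open>i\<close> and \<open>j\<close>; exactly these values are
  overwritten.\<close>

definition insert_pair :: "'n \<Rightarrow> 'n \<Rightarrow> ('n \<Rightarrow> real) \<Rightarrow> real \<times> real \<Rightarrow> real^'n" where
  "insert_pair i j w t = vec_lambda (w(i := fst t, j := snd t))"

lemma measurable_insert_pair [measurable]:
  fixes i j :: "'n::finite"
  shows "(\<lambda>(w, t). insert_pair i j w t) \<in> (\<Pi>\<^sub>M l\<in>UNIV - {i, j}. lborel) \<Otimes>\<^sub>M (lborel \<Otimes>\<^sub>M lborel) \<rightarrow>\<^sub>M borel"
proof -
  have "(\<lambda>p. insert_pair i j (fst p) (snd p) \<bullet> axis l 1)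
      \<in> borel_measurable ((\<Pi>\<^sub>M l\<in>UNIV - {i, j}. lborel) \<Otimes>\<^sub>M (lborel \<Otimes>\<^sub>M lborel))" for l
    by (cases "l = j"; cases "l = i") (simp_all add: insert_pair_def inner_axis)
  then show ?thesis
    by (subst borel_measurable_euclidean_space) (auto simp: Basis_vec_def split_beta')
qed

lemma nn_integral_lborel_insert_pair:
  fixes i j :: "'n::finite" and h :: "real^'n \<Rightarrow> ennreal"
  assumes ij: "i \<noteq> j" and h [measurable]: "h \<in> borel_measurable borel"
  shows "(\<integral>\<^sup>+y. h y \<partial>lborel)
    = (\<integral>\<^sup>+w. \<integral>\<^sup>+t. h (insert_pair i j w t) \<partial>(lborel \<Otimes>\<^sub>M lborel) \<partial>(\<Pi>\<^sub>M l\<in>UNIV - {i, j}. lborel))"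
proof -
  interpret product_sigma_finite "\<lambda>_::'n. lborel :: real measure" ..
  let ?I = "UNIV - {i, j}"
  have UNIV_eq: "UNIV = insert j (insert i ?I)" using ij by auto
  have V [measurable]: "vec_lambda \<in> (\<Pi>\<^sub>M l\<in>(UNIV :: 'n set). lborel) \<rightarrow>\<^sub>M (borel :: (real^'n) measure)"
    using measurable_vec_lambda by (simp cong: measurable_cong_sets sets_PiM_cong)
  have hV: "(\<lambda>f. h (vec_lambda f)) \<in> borel_measurable (\<Pi>\<^sub>M l\<in>insert j (insert i ?I). lborel)"
    unfolding UNIV_eq[symmetric] by measurable
  have "(\<integral>\<^sup>+y. h y \<partial>lborel) = (\<integral>\<^sup>+f. h (vec_lambda f) \<partial>(\<Pi>\<^sub>M l\<in>UNIV. lborel))"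
    by (subst lborel_eq_distr_PiM) (simp add: nn_integral_distr)
  also have "\<dots> = (\<integral>\<^sup>+f. h (vec_lambda f) \<partial>(\<Pi>\<^sub>M l\<in>insert j (insert i ?I). lborel))"
    by (simp only: UNIV_eq[symmetric])
  \<comment> \<open>Splitting off \<open>j\<close> before \<open>i\<close> leaves \<open>i\<close>
    in the outer integral, which matches the order of the components of \<open>t\<close>.\<close>
  also have "\<dots> = (\<integral>\<^sup>+f. \<integral>\<^sup>+z. h (vec_lambda (f(j := z))) \<partial>lborel \<partial>(\<Pi>\<^sub>M l\<in>insert i ?I. lborel))"
    using ij hV by (subst product_nn_integral_insert) auto
  also have "\<dots> = (\<integral>\<^sup>+w. \<integral>\<^sup>+x. \<integral>\<^sup>+z. h (vec_lambda (w(i := x, j := z))) \<partial>lborel \<partial>lborel \<partial>(\<Pi>\<^sub>M l\<in>?I. lborel))"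
  proof (subst product_nn_integral_insert)
    have "(\<lambda>(f, z). f(j := z)) \<in> (\<Pi>\<^sub>M l\<in>insert i ?I. lborel) \<Otimes>\<^sub>M lborel \<rightarrow>\<^sub>M (\<Pi>\<^sub>M l\<in>insert j (insert i ?I). lborel)"
      by (rule measurable_add_dim)
    from measurable_compose[OF this hV]
    have [measurable]: "(\<lambda>(f, z). h (vec_lambda (f(j := z)))) \<in> borel_measurable ((\<Pi>\<^sub>M l\<in>insert i ?I. lborel) \<Otimes>\<^sub>M lborel)"
      by (simp add: split_beta')
    show "(\<lambda>f. \<integral>\<^sup>+z. h (vec_lambda (f(j := z))) \<partial>lborel) \<in> borel_measurable (\<Pi>\<^sub>M l\<in>insert i ?I. lborel)"
      by measurable
  qed auto
  also have "\<dots> = (\<integral>\<^sup>+w. \<integral>\<^sup>+t. h (insert_pair i j w t) \<partial>(lborel \<Otimes>\<^sub>M lborel) \<partial>(\<Pi>\<^sub>M l\<in>?I. lborel))"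
  proof (intro nn_integral_cong)
    fix w assume w [measurable]: "w \<in> space (\<Pi>\<^sub>M l\<in>?I. lborel :: real measure)"
    have "(\<lambda>t. insert_pair i j w t) \<in> lborel \<Otimes>\<^sub>M lborel \<rightarrow>\<^sub>M borel"
      using measurable_compose[OF measurable_Pair1'[OF w] measurable_insert_pair] by simp
    then have "(\<lambda>t. h (insert_pair i j w t)) \<in> borel_measurable (lborel \<Otimes>\<^sub>M lborel)"
      by measurable
    from lborel.nn_integral_fst[OF this, symmetric]
    show "(\<integral>\<^sup>+x. \<integral>\<^sup>+z. h (vec_lambda (w(i := x, j := z))) \<partial>lborel \<partial>lborel)
      = (\<integral>\<^sup>+t. h (insert_pair i j w t) \<partial>(lborel \<Otimes>\<^sub>M lborel))"
      by (simp add: insert_pair_def)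
  qed
  finally show ?thesis .
qed


section \<open>The Huesler--Reiss density\<close>

text \<open>The logarithm, up to an additive constant, of the exponent measure density at \<open>y\<close>, where \<open>u = ln y\<close>.\<close>

definition HR_log_density :: "real^'n^'n \<Rightarrow> 'n \<Rightarrow> real^'n \<Rightarrow> real" where
  "HR_log_density \<Gamma> k u =
     - ((u + (\<chi> a. \<Gamma> $ a $ k / 2)) \<bullet> (HR_precision \<Gamma> k *v (u + (\<chi> a. \<Gamma> $ a $ k / 2)))) / 2
     - (\<Sum>a\<in>UNIV. u $ a) - u $ k"

text \<open>Zero row and column sums make the form invariant under shifts along the constant vector.
  The shift by \<open>p $ k\<close> makes coordinate \<open>k\<close> vanish, and with it the
  contribution of the border.\<close>

lemma HR_quadratic_form:
  fixes \<Gamma> :: "real^'n^'n"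
  assumes \<Gamma>: "HR_parameter_matrix \<Gamma>" and p: "p $ k = s"
  shows "(\<Sum>a\<in>UNIV - {k}. \<Sum>b\<in>UNIV - {k}. (p $ a - s) * HR_Theta \<Gamma> k a b * (p $ b - s))
    = p \<bullet> (HR_precision \<Gamma> k *v p)"
proof -
  let ?T = "\<lambda>a b. HR_precision \<Gamma> k $ a $ b"
  have "(\<Sum>a\<in>UNIV - {k}. \<Sum>b\<in>UNIV - {k}. (p $ a - s) * HR_Theta \<Gamma> k a b * (p $ b - s))
      = (\<Sum>a\<in>UNIV - {k}. \<Sum>b\<in>UNIV - {k}. (p $ a - s) * ?T a b * (p $ b - s))"
    by (intro sum.cong refl) (auto simp: HR_precision_def)
  also have "\<dots> = (\<Sum>a\<in>UNIV - {k}. \<Sum>b\<in>UNIV. (p $ a - s) * ?T a b * (p $ b - s))"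
    by (intro sum.cong refl sum.mono_neutral_left) (auto simp: p)
  also have "\<dots> = (\<Sum>a\<in>UNIV. \<Sum>b\<in>UNIV. (p $ a - s) * ?T a b * (p $ b - s))"
    by (intro sum.mono_neutral_left) (auto simp: p)
  also have "\<dots> = (\<Sum>a\<in>UNIV. (p $ a - s) * (\<Sum>b\<in>UNIV. ?T a b * p $ b) - (p $ a - s) * s * (\<Sum>b\<in>UNIV. ?T a b))"
    unfolding sum_distrib_left sum_subtractf[symmetric]
    by (intro sum.cong refl) (simp add: algebra_simps)
  also have "\<dots> = (\<Sum>a\<in>UNIV. p $ a * (\<Sum>b\<in>UNIV. ?T a b * p $ b)) - s * (\<Sum>a\<in>UNIV. \<Sum>b\<in>UNIV. ?T a b * p $ b)"
    by (simp add: HR_precision_row_sum[OF \<Gamma>] left_diff_distrib sum_subtractf flip: sum_distrib_left[of s])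
  also have "(\<Sum>a\<in>UNIV. \<Sum>b\<in>UNIV. ?T a b * p $ b) = (\<Sum>b\<in>UNIV. (\<Sum>a\<in>UNIV. ?T a b) * p $ b)"
    unfolding sum_distrib_right by (rule sum.swap)
  finally show ?thesis
    by (simp add: HR_precision_column_sum inner_vec_def matrix_vector_mult_def)
qed

text \<open>As the diagonal of \<Gamma> vanishes, the arguments of the Gaussian factor are
  differences \<open>p $ a - p $ k\<close>. The prefactor has one inverse power for each coordinate
  and a second one for \<open>k\<close>, which gives the linear terms of
  \<open>HR_log_density\<close>.\<close>

lemma HR_exponent_density_eq:
  fixes \<Gamma> :: "real^'n^'n"
  assumes \<Gamma>: "HR_parameter_matrix \<Gamma>" and y: "\<And>l. 0 < y $ l"
  shows "HR_exponent_density \<Gamma> k y = exp (HR_log_density \<Gamma> k (\<chi> l. ln (y $ l)))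
    / sqrt ((2 * pi) ^ card (UNIV - {k}) * det_on (UNIV - {k}) (HR_Sigma \<Gamma> k))"
proof -
  define p :: "real^'n" where "p = (\<chi> l. ln (y $ l)) + (\<chi> a. \<Gamma> $ a $ k / 2)"
  have pk: "p $ k = ln (y $ k)" by (simp add: p_def HR_parameter_matrix_diag[OF \<Gamma>])
  have v: "ln (y $ a / y $ k) + \<Gamma> $ a $ k / 2 = p $ a - ln (y $ k)" for a
    using y[of a] y[of k] by (simp add: p_def ln_div)
  have "exp (- (\<Sum>a\<in>UNIV. ln (y $ a)) - ln (y $ k)) = (\<Prod>a\<in>UNIV. inverse (y $ a)) * inverse (y $ k)"
    using y by (simp add: exp_diff exp_minus exp_sum divide_inverse flip: sum_negf)
  also have "\<dots> = inverse ((y $ k)\<^sup>2) * (\<Prod>a\<in>UNIV - {k}. inverse (y $ a))"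
    by (simp add: prod.remove[of UNIV k] power2_eq_square)
  finally have pre: "inverse ((y $ k)\<^sup>2) * (\<Prod>a\<in>UNIV - {k}. inverse (y $ a))
      = exp (- (\<Sum>a\<in>UNIV. ln (y $ a)) - ln (y $ k))" ..
  have "HR_log_density \<Gamma> k (\<chi> l. ln (y $ l))
      = (- (\<Sum>a\<in>UNIV. ln (y $ a)) - ln (y $ k)) + - (p \<bullet> (HR_precision \<Gamma> k *v p)) / 2"
    by (simp add: HR_log_density_def p_def)
  then have "exp (HR_log_density \<Gamma> k (\<chi> l. ln (y $ l)))
      = exp (- (\<Sum>a\<in>UNIV. ln (y $ a)) - ln (y $ k)) * exp (- (p \<bullet> (HR_precision \<Gamma> k *v p)) / 2)"
    by (simp only: exp_add)
  then show ?thesis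
    unfolding HR_exponent_density_def mvn_density_def v HR_Theta_def[symmetric] HR_quadratic_form[OF \<Gamma> pk]
    using y pre by simp
qed

text \<open>A mixed second difference of a quadratic polynomial retains only the bilinear cross
  term; the symmetry of the matrix doubles it and cancels the factor 1/2.\<close>

lemma HR_log_density_mixed:
  fixes \<Gamma> :: "real^'n^'n"
  assumes \<Gamma>: "HR_parameter_matrix \<Gamma>"
  shows "HR_log_density \<Gamma> k (u + axis i s + axis j t) + HR_log_density \<Gamma> k u
    = HR_log_density \<Gamma> k (u + axis i s) + HR_log_density \<Gamma> k (u + axis j t) - HR_precision \<Gamma> k $ i $ j * s * t"
proof -
  let ?T = "HR_precision \<Gamma> k"
  define p where "p = u + (\<chi> a. \<Gamma> $ a $ k / 2)"
  have sym: "x \<bullet> (?T *v z) = z \<bullet> (?T *v x)" for x z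
    by (metis dot_lmul_matrix inner_commute transpose_HR_precision[OF \<Gamma>] transpose_matrix_vector)
  have ij: "axis i s \<bullet> (?T *v axis j t) = ?T $ i $ j * s * t"
  proof -
    have "(\<Sum>b\<in>UNIV. ?T $ i $ b * axis j t $ b) = (\<Sum>b\<in>UNIV. if b = j then ?T $ i $ j * t else 0)"
      by (intro sum.cong) (auto simp: axis_def)
    then show ?thesis by (simp add: inner_axis' matrix_vector_mult_def)
  qed
  have re: "u + axis i s + axis j t + (\<chi> a. \<Gamma> $ a $ k / 2) = p + axis i s + axis j t"
    "u + axis i s + (\<chi> a. \<Gamma> $ a $ k / 2) = p + axis i s"
    "u + axis j t + (\<chi> a. \<Gamma> $ a $ k / 2) = p + axis j t"
    "u + (\<chi> a. \<Gamma> $ a $ k / 2) = p"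
    by (simp_all add: p_def)
  show ?thesis
    unfolding HR_log_density_def re
    by (simp add: inner_add_left inner_add_right matrix_vector_right_distrib sum.distrib
        sym[of "axis j t" "axis i s"] sym[of "axis i s" p] sym[of "axis j t" p] ij field_simps)
qed

section \<open>The truncated, unnormalised density on a fibre\<close>

text \<open>\<open>Pareto_support\<close> does not appear: for positive \<open>y\<close> the
  condition \<open>1 < y $ m\<close> already implies membership.\<close>

definition HR_kernel :: "real^'n^'n \<Rightarrow> 'n \<Rightarrow> 'n \<Rightarrow> real^'n \<Rightarrow> real" where
  "HR_kernel \<Gamma> k m y =
     (if (\<forall>l. 0 < y $ l) \<and> 1 < y $ m then exp (HR_log_density \<Gamma> k (\<chi> l. ln (y $ l))) else 0)"

lemma measurable_HR_log_density [measurable]: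
  "(\<lambda>y. HR_log_density \<Gamma> k (\<chi> l. ln (y $ l))) \<in> borel_measurable borel"
  unfolding HR_log_density_def inner_vec_def matrix_vector_mult_def by simp

lemma measurable_HR_kernel [measurable]: "HR_kernel \<Gamma> k m \<in> borel_measurable borel"
  unfolding HR_kernel_def[abs_def] by measurable

lemma insert_pair_nth:
  "insert_pair i j w t $ l = (if l = j then snd t else if l = i then fst t else w l)"
  by (simp add: insert_pair_def)

lemma insert_pair_positive:
  assumes "i \<noteq> j"
  shows "(\<forall>l. 0 < insert_pair i j w t $ l) \<longleftrightarrow> (\<forall>l\<in>UNIV - {i, j}. 0 < w l) \<and> 0 < fst t \<and> 0 < snd t"
proof -
  have split: "(\<forall>l. P l) \<longleftrightarrow> (\<forall>l\<in>UNIV - {i, j}. P l) \<and> P i \<and> P j" for P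
    by (metis DiffI UNIV_I insertE singletonD)
  have "(\<forall>l\<in>UNIV - {i, j}. 0 < insert_pair i j w t $ l) \<longleftrightarrow> (\<forall>l\<in>UNIV - {i, j}. 0 < w l)"
    by (intro ball_cong refl) (simp add: insert_pair_nth)
  then show ?thesis
    unfolding split[of "\<lambda>l. 0 < insert_pair i j w t $ l"]
    using assms by (simp only: insert_pair_nth[of _ _ _ _ i] insert_pair_nth[of _ _ _ _ j] if_True if_False refl)
qed

lemma HR_kernel_insert_pair:
  assumes "i \<noteq> j"
  shows "HR_kernel \<Gamma> k m (insert_pair i j w t) =
    (if (\<forall>l\<in>UNIV - {i, j}. 0 < w l) \<and> 0 < fst t \<and> 0 < snd t
        \<and> 1 < (if m = j then snd t else if m = i then fst t else w m)
     then exp (HR_log_density \<Gamma> k (\<chi> l. ln (insert_pair i j w t $ l))) else 0)"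
  unfolding HR_kernel_def insert_pair_positive[OF assms] insert_pair_nth[of _ _ _ _ m] by simp

lemma HR_kernel_mixed:
  fixes \<Gamma> :: "real^'n^'n" and w :: "'n \<Rightarrow> real" and k m i j :: 'n
  assumes \<Gamma>: "HR_parameter_matrix \<Gamma>" and ij: "i \<noteq> j" and r: "1 < r"
  defines "K \<equiv> \<lambda>x z. HR_kernel \<Gamma> k m (insert_pair i j w (x, z))"
  shows "K x z * K r r = K x r * K r z * exp (- HR_precision \<Gamma> k $ i $ j * (ln x - ln r) * (ln z - ln r))"
proof -
  define D where "D x z \<longleftrightarrow> (\<forall>l\<in>UNIV - {i, j}. 0 < w l) \<and> 0 < x \<and> 0 < z
    \<and> 1 < (if m = j then z else if m = i then x else w m)" for x z
  let ?u = "\<lambda>x z. \<chi> l. ln (insert_pair i j w (x, z) $ l)"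
  have K: "K x z = (if D x z then exp (HR_log_density \<Gamma> k (?u x z)) else 0)" for x z
    unfolding K_def HR_kernel_insert_pair[OF ij] D_def by simp
  \<comment> \<open>Every constraint concerns a single coordinate or \<open>w\<close> alone, and
    \<open>r\<close> satisfies those on \<open>i\<close> and \<open>j\<close>. Hence the two sides
    of the claim vanish together.\<close>
  have D_swap: "D x z \<and> D r r \<longleftrightarrow> D x r \<and> D r z"
    using r unfolding D_def by auto
  show ?thesis
  proof (cases "D x z \<and> D r r")
    case True
    have u: "?u x r = ?u r r + axis i (ln x - ln r)" "?u r z = ?u r r + axis j (ln z - ln r)"
      "?u x z = ?u r r + axis i (ln x - ln r) + axis j (ln z - ln r)"
      using ij by (simp_all add: vec_eq_iff insert_pair_nth axis_def)
    have "HR_log_density \<Gamma> k (?u x z) + HR_log_density \<Gamma> k (?u r r)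
      = HR_log_density \<Gamma> k (?u x r) + HR_log_density \<Gamma> k (?u r z)
        + - HR_precision \<Gamma> k $ i $ j * (ln x - ln r) * (ln z - ln r)"
      unfolding u using HR_log_density_mixed[OF \<Gamma>] by simp
    then show ?thesis using True D_swap by (simp add: K flip: exp_add)
  next
    case False
    then show ?thesis using D_swap by (auto simp: K)
  qed
qed

text \<open>At (r, r) all constraints on the two free coordinates hold, so only \<open>w\<close> can
  be responsible for the zero.\<close>

lemma HR_kernel_eq_0:
  assumes "i \<noteq> j" "1 < r" "HR_kernel \<Gamma> k m (insert_pair i j w (r, r)) = 0"
  shows "HR_kernel \<Gamma> k m (insert_pair i j w t) = 0"
  using assms(2,3) unfolding HR_kernel_insert_pair[OF assms(1)] by (auto split: if_splits)

text \<open>With \<open>m\<close> outside the pair the truncation restricts \<open>w\<close> only: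
  the fibre density is positive on the whole open quadrant or nowhere.\<close>

lemma HR_kernel_neq_0:
  assumes "i \<noteq> j" "HR_kernel \<Gamma> k m (insert_pair i j w t) \<noteq> 0" "m \<noteq> i" "m \<noteq> j" "0 < x" "0 < z"
  shows "HR_kernel \<Gamma> k m (insert_pair i j w (x, z)) \<noteq> 0"
  using assms(2-) unfolding HR_kernel_insert_pair[OF assms(1)] by (auto split: if_splits)

lemma HR_kernel_nonneg: "0 \<le> HR_kernel \<Gamma> k m y"
  by (simp add: HR_kernel_def)

text \<open>The Gaussian normalising constant, the total mass of the exponent measure and the
  probability of the conditioning event merge into the single factor \<open>a\<close>, which later
  arguments need only be positive.\<close>

lemma HR_Pareto_conditional_law:
  fixes Y :: "'a \<Rightarrow> real^'n"
  assumes "prob_space M" and \<Gamma>: "HR_parameter_matrix \<Gamma>" and Pareto: "HR_Pareto M Y \<Gamma> k"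
  defines "N \<equiv> \<lambda>m. uniform_measure M {\<omega> \<in> space M. Y \<omega> $ m > 1}"
  obtains a where "0 < a" "prob_space (N m)"
    "\<And>h. h \<in> borel_measurable borel \<Longrightarrow>
      (\<integral>\<^sup>+\<omega>. h (Y \<omega>) \<partial>N m) = (\<integral>\<^sup>+y. ennreal (a * HR_kernel \<Gamma> k m y) * h y \<partial>lborel)"
proof -
  interpret prob_space M by fact
  let ?D = "HR_exponent_density \<Gamma> k" and ?\<Lambda> = "HR_Lambda_one \<Gamma> k"
  let ?E = "\<lambda>y::real^'n. exp (HR_log_density \<Gamma> k (\<chi> l. ln (y $ l)))"
  let ?S = "{\<omega> \<in> space M. Y \<omega> $ m > 1}"
  define C where "C = 1 / sqrt ((2 * pi) ^ card (UNIV - {k}) * det_on (UNIV - {k}) (HR_Sigma \<Gamma> k))"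
  define f where "f y = ennreal (?D y) / ?\<Lambda> * indicator Pareto_support y" for y :: "real^'n"
  have D: "?D y = (if \<forall>l. 0 < y $ l then C * ?E y else 0)" for y
  proof (cases "\<forall>l. 0 < y $ l")
    case True
    then show ?thesis using HR_exponent_density_eq[OF \<Gamma>, of y k] by (simp add: C_def)
  qed (auto simp: HR_exponent_density_def)
  have D_meas [measurable]: "?D \<in> borel_measurable borel"
    unfolding D[abs_def] by measurable
  have supp_meas [measurable]: "(Pareto_support :: (real^'n) set) \<in> sets borel"
  proof -
    have "(\<lambda>x::real^'n. infnorm x) \<in> borel_measurable borel"
      by (intro borel_measurable_continuous_onI continuous_intros)
    then show ?thesis unfolding Pareto_support_def by measurable
  qed
  have dist: "distributed M lborel Y f"
    using Pareto unfolding HR_Pareto_def f_def .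
  have Y [measurable]: "Y \<in> M \<rightarrow>\<^sub>M borel"
    using distributed_measurable[OF dist] by simp
  have f_meas [measurable]: "f \<in> borel_measurable borel"
    using distributed_borel_measurable[OF dist] by simp
  have one: "(\<integral>\<^sup>+y. f y \<partial>lborel) = 1"
    using distributed_nn_integral[OF dist, of "\<lambda>_. 1"] by (simp add: emeasure_space_1)
  txt \<open>
    A nonpositive determinant would give a junk value \<open>C \<le> 0\<close>. This, like \<open>\<Lambda>(1) = \<infinity>\<close>, would
    contradict that the density has total mass 1.
  \<close>
  have "0 < C"
  proof (rule ccontr)
    assume "\<not> 0 < C"
    then have "?D y \<le> 0" for y unfolding D by (simp add: mult_nonpos_nonneg)
    then have "f y = 0" for y by (simp add: f_def ennreal_neg)
    then show False using one by simp
  qed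
  have "(\<integral>\<^sup>+y. f y \<partial>lborel) = (\<integral>\<^sup>+y. ennreal (?D y) * indicator Pareto_support y / ?\<Lambda> \<partial>lborel)"
    by (intro nn_integral_cong) (simp add: f_def divide_ennreal_def ac_simps)
  also have "\<dots> = ?\<Lambda> / ?\<Lambda>"
    unfolding HR_Lambda_one_def by (rule nn_integral_divide) measurable
  finally have "?\<Lambda> \<noteq> top" "?\<Lambda> \<noteq> 0"
    using one divide_eq_1_ennreal[of ?\<Lambda> ?\<Lambda>] by simp_all
  then obtain z where z: "?\<Lambda> = ennreal z" "0 < z"
    by (cases ?\<Lambda>) (auto simp: less_le)
  have f_eq: "f y * indicator {y. 1 < y $ m} y = ennreal (C / z * HR_kernel \<Gamma> k m y)" for y
  proof (cases "(\<forall>l. 0 < y $ l) \<and> 1 < y $ m")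
    case True
    then have "1 < infnorm y"
      using component_le_infnorm_cart[of y m] by linarith
    with True have "y \<in> Pareto_support" by (auto simp: Pareto_support_def less_imp_le)
    with True \<open>0 < C\<close> z show ?thesis
      by (simp add: f_def D HR_kernel_def divide_ennreal)
  next
    case False
    then show ?thesis by (auto simp: f_def D HR_kernel_def)
  qed
  have S [measurable]: "?S \<in> sets M" by measurable
  have law_S: "(\<integral>\<^sup>+\<omega>. h (Y \<omega>) * indicator ?S \<omega> \<partial>M)
      = (\<integral>\<^sup>+y. ennreal (C / z * HR_kernel \<Gamma> k m y) * h y \<partial>lborel)"
    if [measurable]: "h \<in> borel_measurable borel" for h :: "_ \<Rightarrow> ennreal"
  proof -
    have "(\<integral>\<^sup>+\<omega>. h (Y \<omega>) * indicator ?S \<omega> \<partial>M) = (\<integral>\<^sup>+\<omega>. h (Y \<omega>) * indicator {y. 1 < y $ m} (Y \<omega>) \<partial>M)"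
      by (intro nn_integral_cong) (auto split: split_indicator)
    also have "\<dots> = (\<integral>\<^sup>+y. f y * (h y * indicator {y. 1 < y $ m} y) \<partial>lborel)"
      by (rule distributed_nn_integral[OF dist, symmetric]) simp
    also have "\<dots> = (\<integral>\<^sup>+y. ennreal (C / z * HR_kernel \<Gamma> k m y) * h y \<partial>lborel)"
      unfolding f_eq[symmetric] by (simp add: ac_simps)
    finally show ?thesis .
  qed
  \<comment> \<open>The kernel is positive on the cube with all coordinates between 1 and 2, whose
    Lebesgue measure is 1.\<close>
  have "emeasure M ?S \<noteq> 0"
  proof
    assume "emeasure M ?S = 0"
    then have "(\<integral>\<^sup>+y. ennreal (C / z * HR_kernel \<Gamma> k m y) \<partial>lborel) = 0"
      using law_S[of "\<lambda>_. 1"] S by simp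
    then have "AE y in lborel. ennreal (C / z * HR_kernel \<Gamma> k m y) = 0"
      by (subst (asm) nn_integral_0_iff_AE) auto
    then have "AE y in lborel. y \<notin> box (vec 1) (vec 2 :: real^'n)"
    proof (rule AE_mp, intro AE_I2 impI notI)
      fix y :: "real^'n" assume y: "y \<in> box (vec 1) (vec 2)" and "ennreal (C / z * HR_kernel \<Gamma> k m y) = 0"
      then have "HR_kernel \<Gamma> k m y \<le> 0" using \<open>0 < C\<close> \<open>0 < z\<close>
        by (simp add: ennreal_eq_0_iff mult_le_0_iff divide_le_0_iff)
      moreover have "1 < y $ l" for l using y by (simp add: mem_box_cart)
      then have "(\<forall>l. 0 < y $ l) \<and> 1 < y $ m" by (meson less_trans zero_less_one)
      ultimately show False by (simp add: HR_kernel_def not_le[symmetric])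
    qed
    then have "emeasure lborel (box (vec 1) (vec 2 :: real^'n)) = 0"
      by (subst (asm) AE_iff_measurable[of "box (vec 1) (vec 2)"]) auto
    moreover have "emeasure lborel (box (vec 1) (vec 2 :: real^'n)) = (\<Prod>b\<in>Basis. (vec 2 - vec 1 :: real^'n) \<bullet> b)"
      by (rule emeasure_lborel_box) (auto simp: Basis_vec_def inner_axis)
    moreover have "(\<Prod>b\<in>Basis. (vec 2 - vec 1 :: real^'n) \<bullet> b) = 1"
      by (rule prod.neutral) (auto simp: Basis_vec_def inner_axis)
    ultimately show False by simp
  qed
  moreover have "emeasure M ?S \<le> 1" by (rule emeasure_le_1)
  ultimately obtain p where p: "emeasure M ?S = ennreal p" "0 < p"
    by (cases "emeasure M ?S") (auto simp: less_le)
  show thesis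
  proof
    show "0 < C / (z * p)" using \<open>0 < C\<close> \<open>0 < z\<close> \<open>0 < p\<close> by simp
    show "prob_space (N m)"
      unfolding N_def by (rule prob_space_uniform_measure) (use p in auto)
    fix h :: "real^'n \<Rightarrow> ennreal" assume h [measurable]: "h \<in> borel_measurable borel"
    have "(\<integral>\<^sup>+\<omega>. h (Y \<omega>) \<partial>N m) = (\<integral>\<^sup>+y. ennreal (C / z * HR_kernel \<Gamma> k m y) * h y \<partial>lborel) / ennreal p"
      unfolding N_def by (subst nn_integral_uniform_measure) (simp_all add: law_S p)
    also have "\<dots> = (\<integral>\<^sup>+y. ennreal (C / z * HR_kernel \<Gamma> k m y) * h y / ennreal p \<partial>lborel)"
      by (rule nn_integral_divide[symmetric]) measurable
    also have "\<dots> = (\<integral>\<^sup>+y. ennreal (C / (z * p) * HR_kernel \<Gamma> k m y) * h y \<partial>lborel)"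
    proof (rule nn_integral_cong)
      fix y
      have "0 \<le> C / z * HR_kernel \<Gamma> k m y"
        using \<open>0 < C\<close> \<open>0 < z\<close> HR_kernel_nonneg[of \<Gamma> k m y] by simp
      then have "ennreal (C / z * HR_kernel \<Gamma> k m y) / ennreal p = ennreal (C / (z * p) * HR_kernel \<Gamma> k m y)"
        using p(2) by (simp add: divide_ennreal)
      then show "ennreal (C / z * HR_kernel \<Gamma> k m y) * h y / ennreal p
          = ennreal (C / (z * p) * HR_kernel \<Gamma> k m y) * h y"
        by (metis divide_ennreal_def mult.assoc mult.commute)
    qed
    finally show "(\<integral>\<^sup>+\<omega>. h (Y \<omega>) \<partial>N m)
      = (\<integral>\<^sup>+y. ennreal (C / (z * p) * HR_kernel \<Gamma> k m y) * h y \<partial>lborel)" .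
  qed
qed


section \<open>Extremal conditional independence\<close>

lemma joint_density_insert_pair:
  fixes Y :: "'a \<Rightarrow> real^'n" and \<kappa> :: "real^'n \<Rightarrow> ennreal"
  assumes "prob_space N" and Y [measurable]: "Y \<in> N \<rightarrow>\<^sub>M borel"
    and \<kappa> [measurable]: "\<kappa> \<in> borel_measurable borel" and ij: "i \<noteq> j"
    and law: "\<And>h. h \<in> borel_measurable borel \<Longrightarrow>
      (\<integral>\<^sup>+\<omega>. h (Y \<omega>) \<partial>N) = (\<integral>\<^sup>+y. \<kappa> y * h y \<partial>lborel)"
  shows "joint_density N (\<Pi>\<^sub>M l\<in>UNIV - {i, j}. lborel) (lborel \<Otimes>\<^sub>M lborel)
    (\<lambda>\<omega>. \<lambda>l\<in>UNIV - {i, j}. Y \<omega> $ l) (\<lambda>\<omega>. (Y \<omega> $ i, Y \<omega> $ j)) (\<lambda>(w, t). \<kappa> (insert_pair i j w t))"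
proof -
  let ?I = "UNIV - {i, j}" and ?R = "lborel \<Otimes>\<^sub>M lborel :: (real \<times> real) measure"
  let ?L = "\<Pi>\<^sub>M l\<in>?I. lborel :: real measure"
  interpret prob_space N by fact
  show ?thesis
  proof (intro joint_density.intro joint_density_axioms.intro)
    show "prob_space N" by fact
    show "sigma_finite_measure ?R"
      by (simp add: lborel_prod sigma_finite_lborel)
    have W: "(\<lambda>y::real^'n. \<lambda>l\<in>?I. y $ l) \<in> borel \<rightarrow>\<^sub>M ?L"
      by (intro measurable_restrict) simp
    show "(\<lambda>\<omega>. \<lambda>l\<in>?I. Y \<omega> $ l) \<in> N \<rightarrow>\<^sub>M ?L"
      by (intro measurable_restrict) simp
    show "(\<lambda>\<omega>. (Y \<omega> $ i, Y \<omega> $ j)) \<in> N \<rightarrow>\<^sub>M ?R" by simp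
    show "(\<lambda>(w, t). \<kappa> (insert_pair i j w t)) \<in> borel_measurable (?L \<Otimes>\<^sub>M ?R)"
      using measurable_compose[OF measurable_insert_pair \<kappa>] by (simp add: split_beta')
    fix h :: "('n \<Rightarrow> real) \<times> real \<times> real \<Rightarrow> ennreal" assume [measurable]: "h \<in> borel_measurable (?L \<Otimes>\<^sub>M ?R)"
    have h' [measurable]: "(\<lambda>y. h (\<lambda>l\<in>?I. y $ l, y $ i, y $ j)) \<in> borel_measurable borel"
      using W by measurable
    have "(\<integral>\<^sup>+\<omega>. h (\<lambda>l\<in>?I. Y \<omega> $ l, Y \<omega> $ i, Y \<omega> $ j) \<partial>N)
        = (\<integral>\<^sup>+y. \<kappa> y * h (\<lambda>l\<in>?I. y $ l, y $ i, y $ j) \<partial>lborel)"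
      by (rule law[OF h'])
    also have "\<dots> = (\<integral>\<^sup>+w. \<integral>\<^sup>+t. \<kappa> (insert_pair i j w t) * h (\<lambda>l\<in>?I. insert_pair i j w t $ l,
        insert_pair i j w t $ i, insert_pair i j w t $ j) \<partial>?R \<partial>?L)"
      by (rule nn_integral_lborel_insert_pair[OF ij]) measurable
    also have "\<dots> = (\<integral>\<^sup>+w. \<integral>\<^sup>+t. (case (w, t) of (w, t) \<Rightarrow> \<kappa> (insert_pair i j w t)) * h (w, t) \<partial>?R \<partial>?L)"
    proof (intro nn_integral_cong)
      fix w :: "'n \<Rightarrow> real" and t :: "real \<times> real" assume "w \<in> space ?L"
      then have "(\<lambda>l\<in>?I. insert_pair i j w t $ l) = w"
        by (auto simp: space_PiM PiE_def extensional_def insert_pair_nth fun_eq_iff)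
      moreover have "insert_pair i j w t $ i = fst t" "insert_pair i j w t $ j = snd t"
        using ij by (simp_all add: insert_pair_nth)
      ultimately show "\<kappa> (insert_pair i j w t) * h (\<lambda>l\<in>?I. insert_pair i j w t $ l,
          insert_pair i j w t $ i, insert_pair i j w t $ j)
        = (case (w, t) of (w, t) \<Rightarrow> \<kappa> (insert_pair i j w t)) * h (w, t)" by simp
    qed
    finally show "(\<integral>\<^sup>+\<omega>. h (\<lambda>l\<in>?I. Y \<omega> $ l, Y \<omega> $ i, Y \<omega> $ j) \<partial>N)
      = (\<integral>\<^sup>+w. \<integral>\<^sup>+t. (case (w, t) of (w, t) \<Rightarrow> \<kappa> (insert_pair i j w t)) * h (w, t) \<partial>?R \<partial>?L)" .
  qed
qed

section \<open>Product structure and interaction on the fibres\<close>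

context
  fixes \<Gamma> :: "real^'n^'n" and k m i j :: 'n and a :: real
  assumes \<Gamma>: "HR_parameter_matrix \<Gamma>" and ij: "i \<noteq> j" and a: "0 < a"
begin

private definition \<phi> :: "('n \<Rightarrow> real) \<times> real \<times> real \<Rightarrow> ennreal" where
  "\<phi> = (\<lambda>(w, t). ennreal (a * HR_kernel \<Gamma> k m (insert_pair i j w t)))"

private abbreviation J where
  "J A B \<equiv> fibre_mass (lborel \<Otimes>\<^sub>M lborel) \<phi> (A \<times> B)"

private definition e :: "real \<Rightarrow> real \<Rightarrow> real" where
  "e x z = exp (- HR_precision \<Gamma> k $ i $ j * (ln x - ln 2) * (ln z - ln 2))"

private lemma insert_pair_measurable:
  "w \<in> space (\<Pi>\<^sub>M l\<in>UNIV - {i, j}. lborel) \<Longrightarrow> (\<lambda>t. insert_pair i j w t) \<in> borel_measurable (lborel \<Otimes>\<^sub>M lborel)"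
  using measurable_compose[OF measurable_Pair1' measurable_insert_pair[of i j]] by simp

private lemma \<phi>_measurable:
  assumes w: "w \<in> space (\<Pi>\<^sub>M l\<in>UNIV - {i, j}. lborel)"
  shows "(\<lambda>t. \<phi> (w, t)) \<in> borel_measurable (lborel \<Otimes>\<^sub>M lborel)"
    "(\<lambda>x. \<phi> (w, x, z)) \<in> borel_measurable borel" "(\<lambda>z. \<phi> (w, x, z)) \<in> borel_measurable borel"
proof -
  note [measurable] = insert_pair_measurable[OF w]
  show *: "(\<lambda>t. \<phi> (w, t)) \<in> borel_measurable (lborel \<Otimes>\<^sub>M lborel)"
    unfolding \<phi>_def split by measurable
  have "(\<lambda>x. (x, z)) \<in> borel \<rightarrow>\<^sub>M (lborel \<Otimes>\<^sub>M lborel)" "(\<lambda>z. (x, z)) \<in> borel \<rightarrow>\<^sub>M (lborel \<Otimes>\<^sub>M lborel)"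
    by simp_all
  from this[THEN measurable_compose, OF *]
  show "(\<lambda>x. \<phi> (w, x, z)) \<in> borel_measurable borel" "(\<lambda>z. \<phi> (w, x, z)) \<in> borel_measurable borel"
    by simp_all
qed

private lemma \<phi>_mixed: "\<phi> (w, x, z) * \<phi> (w, 2, 2) = \<phi> (w, x, 2) * \<phi> (w, 2, z) * ennreal (e x z)"
proof -
  have "(a * HR_kernel \<Gamma> k m (insert_pair i j w (x, z))) * (a * HR_kernel \<Gamma> k m (insert_pair i j w (2, 2)))
      = (a * HR_kernel \<Gamma> k m (insert_pair i j w (x, 2))) * (a * HR_kernel \<Gamma> k m (insert_pair i j w (2, z))) * e x z"
    using HR_kernel_mixed[OF \<Gamma> ij, of 2 k m w x z] by (simp add: e_def algebra_simps)
  moreover have "0 \<le> e x z" by (simp add: e_def)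
  ultimately show ?thesis
    using arg_cong[of _ _ ennreal] a by (simp add: \<phi>_def HR_kernel_nonneg flip: ennreal_mult)
qed

private lemma \<phi>_finite: "\<phi> p \<noteq> top"
  by (simp add: \<phi>_def split_beta)

private lemma \<phi>_eq_0_iff: "\<phi> (w, t) = 0 \<longleftrightarrow> HR_kernel \<Gamma> k m (insert_pair i j w t) = 0"
  using a HR_kernel_nonneg[of \<Gamma> k m "insert_pair i j w t"]
  by (auto simp: \<phi>_def ennreal_eq_0_iff mult_le_0_iff)

private lemma fibre_mass_product:
  assumes c: "HR_precision \<Gamma> k $ i $ j = 0" and w: "w \<in> space (\<Pi>\<^sub>M l\<in>UNIV - {i, j}. lborel)"
    and AB: "A \<in> sets borel" "B \<in> sets borel"
  shows "J A B w * J UNIV UNIV w = J A UNIV w * J UNIV B w"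
proof (cases "\<phi> (w, 2, 2) = 0")
  case True
  then have "\<phi> (w, t) = 0" for t
    unfolding \<phi>_eq_0_iff using HR_kernel_eq_0[OF ij, of 2 \<Gamma> k m w t] by simp
  then show ?thesis by (simp add: fibre_mass_def)
next
  case False
  have "e x z = 1" for x z by (simp add: e_def c)
  from mass_product[OF \<phi>_measurable(1)[OF w] \<phi>_measurable(2,3)[OF w] \<phi>_mixed False \<phi>_finite this AB]
  show ?thesis unfolding fibre_mass_def .
qed

text \<open>
  The test intervals \<open>U\<close> and \<open>V\<close> lie on either side of the reference point 2, so that the
  interaction factor \<open>e\<close> is bounded away from 1 in opposite directions on \<open>U \<times> U\<close>, \<open>V \<times> V\<close> and on
  \<open>U \<times> V\<close>, \<open>V \<times> U\<close>.
\<close>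

private lemma fibre_mass_cross_ratio:
  assumes c: "HR_precision \<Gamma> k $ i $ j \<noteq> 0" and m: "m \<noteq> i" "m \<noteq> j"
    and w: "w \<in> space (\<Pi>\<^sub>M l\<in>UNIV - {i, j}. lborel)"
    and J: "0 < J UNIV UNIV w" "J UNIV UNIV w < top"
  defines "U \<equiv> {3<..<4::real}" and "V \<equiv> {1<..<3 / 2::real}"
  shows "J U U w * J V V w \<noteq> J U V w * J V U w"
proof -
  let ?c = "HR_precision \<Gamma> k $ i $ j"
  \<comment> \<open>The ratio of 2 to the right end 3/2 of \<open>V\<close> is 4/3, and points of
    \<open>U\<close> exceed 2 by an even larger factor. Thus \<open>\<epsilon> * \<epsilon>\<close>
    bounds the absolute value of the product of the two log differences from below on all four
    rectangles.\<close>
  define \<epsilon> where "\<epsilon> = ln (4 / 3 :: real)"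
  define \<delta> where "\<delta> = exp (\<bar>?c\<bar> * (\<epsilon> * \<epsilon>))"
  have \<epsilon>: "0 < \<epsilon>" by (simp add: \<epsilon>_def)
  have \<delta>: "1 < \<delta>" using c \<epsilon> by (simp add: \<delta>_def)
  have U: "\<epsilon> \<le> ln x - ln 2" if "x \<in> U" for x
  proof -
    have "ln (4 / 3) \<le> ln (x / 2)" using that by (intro ln_mono) (auto simp: U_def)
    then show ?thesis using that by (simp add: \<epsilon>_def U_def ln_div)
  qed
  have V: "\<epsilon> \<le> - (ln x - ln 2)" if "x \<in> V" for x
  proof -
    have "ln (4 / 3) \<le> ln (2 / x)" using that by (intro ln_mono) (auto simp: V_def field_simps)
    then show ?thesis using that by (simp add: \<epsilon>_def V_def ln_div)
  qed
  have same: "\<epsilon> * \<epsilon> \<le> (ln x - ln 2) * (ln z - ln 2)" if "x \<in> U \<and> z \<in> U \<or> x \<in> V \<and> z \<in> V" for x z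
    using that
  proof
    assume "x \<in> U \<and> z \<in> U"
    then have "\<epsilon> \<le> ln x - ln 2" "\<epsilon> \<le> ln z - ln 2" using U by auto
    then show ?thesis using \<epsilon> by (intro mult_mono) linarith+
  next
    assume "x \<in> V \<and> z \<in> V"
    then have "\<epsilon> \<le> - (ln x - ln 2)" "\<epsilon> \<le> - (ln z - ln 2)" using V by blast+
    then have "\<epsilon> * \<epsilon> \<le> (- (ln x - ln 2)) * (- (ln z - ln 2))"
      using \<epsilon> by (intro mult_mono) linarith+
    then show ?thesis by (simp only: minus_mult_minus)
  qed
  have opp: "(ln x - ln 2) * (ln z - ln 2) \<le> - (\<epsilon> * \<epsilon>)" if "x \<in> U \<and> z \<in> V \<or> x \<in> V \<and> z \<in> U" for x z
    using that
  proof
    assume "x \<in> U \<and> z \<in> V"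
    then have "\<epsilon> \<le> ln x - ln 2" "\<epsilon> \<le> - (ln z - ln 2)" using U V by blast+
    then have "\<epsilon> * \<epsilon> \<le> (ln x - ln 2) * (- (ln z - ln 2))"
      using \<epsilon> by (intro mult_mono) linarith+
    then show ?thesis by (simp add: algebra_simps)
  next
    assume "x \<in> V \<and> z \<in> U"
    then have "\<epsilon> \<le> - (ln x - ln 2)" "\<epsilon> \<le> ln z - ln 2" using U V by blast+
    then have "\<epsilon> * \<epsilon> \<le> (- (ln x - ln 2)) * (ln z - ln 2)"
      using \<epsilon> by (intro mult_mono) linarith+
    then show ?thesis by (simp add: algebra_simps)
  qed
  have large: "\<delta> \<le> e x z" if "\<bar>?c\<bar> * (\<epsilon> * \<epsilon>) \<le> - ?c * ((ln x - ln 2) * (ln z - ln 2))" for x z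
    using that by (simp add: \<delta>_def e_def mult.assoc)
  have small: "e x z \<le> 1" if "- ?c * ((ln x - ln 2) * (ln z - ln 2)) \<le> 0" for x z
    using that by (simp add: e_def mult.assoc)
  have q: "\<phi> (w, 2, 2) \<noteq> 0"
  proof
    assume "\<phi> (w, 2, 2) = 0"
    then have "\<phi> (w, t) = 0" for t
      unfolding \<phi>_eq_0_iff using HR_kernel_eq_0[OF ij, of 2 \<Gamma> k m w t] by simp
    then show False using J(1) by (simp add: fibre_mass_def)
  qed
  have pos: "\<phi> (w, x, 2) \<noteq> 0" "\<phi> (w, 2, x) \<noteq> 0" if "0 < x" for x
    using q HR_kernel_neq_0[OF ij _ m] that unfolding \<phi>_eq_0_iff by simp_all
  have pos_int: "(\<integral>\<^sup>+x. \<phi> (w, x, 2) * indicator U x \<partial>lborel) \<noteq> 0" "(\<integral>\<^sup>+x. \<phi> (w, x, 2) * indicator V x \<partial>lborel) \<noteq> 0"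
    "(\<integral>\<^sup>+x. \<phi> (w, 2, x) * indicator U x \<partial>lborel) \<noteq> 0" "(\<integral>\<^sup>+x. \<phi> (w, 2, x) * indicator V x \<partial>lborel) \<noteq> 0"
    unfolding U_def V_def
    by (rule nn_integral_pos_on_interval; use \<phi>_measurable[OF w] pos in simp)+
  have UV: "U \<in> sets borel" "V \<in> sets borel" by (simp_all add: U_def V_def)
  have fin: "J A B w < top" for A B
    using J(2) fibre_mass_less_top[of "lborel \<Otimes>\<^sub>M lborel" \<phi> w "A \<times> B"] by (simp add: space_pair_measure)
  note ratio = mass_cross_ratio[OF \<phi>_measurable(1)[OF w] \<phi>_measurable(2,3)[OF w] \<phi>_mixed q \<phi>_finite \<delta>]
  show ?thesis
  \<comment> \<open>A negative entry makes the interaction large on \<open>U \<times> U\<close> and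
    \<open>V \<times> V\<close>; a positive one makes it large on the other two rectangles, so the
    two products exchange roles.\<close>
  proof (cases "?c < 0")
    case True
    show ?thesis unfolding fibre_mass_def
    proof (rule ratio)
      fix x z
      show "\<delta> \<le> e x z" if "x \<in> U \<and> z \<in> U \<or> x \<in> V \<and> z \<in> V"
        by (rule large) (use same[OF that] True in \<open>simp add: mult_left_mono_neg\<close>)
      show "e x z \<le> 1" if "x \<in> U \<and> z \<in> V \<or> x \<in> V \<and> z \<in> U"
      proof (rule small)
        have "(ln x - ln 2) * (ln z - ln 2) \<le> 0"
          by (rule order.trans[OF opp[OF that]]) simp
        then show "- ?c * ((ln x - ln 2) * (ln z - ln 2)) \<le> 0"
          using True by (simp only: mult_nonneg_nonpos neg_0_le_iff_le less_imp_le)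
      qed
    qed (use UV pos_int fin in \<open>simp_all add: fibre_mass_def\<close>)
  next
    case False
    have "J U V w * J V U w \<noteq> J U U w * J V V w" unfolding fibre_mass_def
    proof (rule ratio)
      fix x z
      show "\<delta> \<le> e x z" if "x \<in> U \<and> z \<in> V \<or> x \<in> V \<and> z \<in> U"
      proof (rule large)
        have "?c * ((ln x - ln 2) * (ln z - ln 2)) \<le> ?c * (- (\<epsilon> * \<epsilon>))"
          using False by (intro mult_left_mono[OF opp[OF that]]) simp
        then show "\<bar>?c\<bar> * (\<epsilon> * \<epsilon>) \<le> - ?c * ((ln x - ln 2) * (ln z - ln 2))" using False by simp
      qed
      show "e x z \<le> 1" if "x \<in> U \<and> z \<in> U \<or> x \<in> V \<and> z \<in> V"
      proof (rule small)
        have "0 \<le> (ln x - ln 2) * (ln z - ln 2)"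
          by (rule order.trans[OF _ same[OF that]]) simp
        then show "- ?c * ((ln x - ln 2) * (ln z - ln 2)) \<le> 0"
          using False by (simp only: mult_nonpos_nonneg neg_le_0_iff_le not_less)
      qed
    qed (use UV pos_int fin in \<open>simp_all add: fibre_mass_def\<close>)
    then show ?thesis by simp
  qed
qed

lemma cond_indep_var_iff_HR_precision:
  fixes X Z :: "'a \<Rightarrow> real"
  assumes "joint_density N (\<Pi>\<^sub>M l\<in>UNIV - {i, j}. lborel) (lborel \<Otimes>\<^sub>M lborel) W (\<lambda>\<omega>. (X \<omega>, Z \<omega>))
    (\<lambda>(w, t). ennreal (a * HR_kernel \<Gamma> k m (insert_pair i j w t)))"
  shows "HR_precision \<Gamma> k $ i $ j = 0 \<Longrightarrow>
      cond_indep_var N borel X borel Z (\<Pi>\<^sub>M l\<in>UNIV - {i, j}. lborel) W"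
    and "m \<noteq> i \<Longrightarrow> m \<noteq> j \<Longrightarrow> cond_indep_var N borel X borel Z (\<Pi>\<^sub>M l\<in>UNIV - {i, j}. lborel) W \<Longrightarrow>
      HR_precision \<Gamma> k $ i $ j = 0"
proof -
  interpret joint_density N "\<Pi>\<^sub>M l\<in>UNIV - {i, j}. lborel" "lborel \<Otimes>\<^sub>M lborel" W "\<lambda>\<omega>. (X \<omega>, Z \<omega>)" \<phi>
    using assms unfolding \<phi>_def .
  note iff = cond_indep_var_iff_fibre_mass[OF assms, folded \<phi>_def]
  show "cond_indep_var N borel X borel Z (\<Pi>\<^sub>M l\<in>UNIV - {i, j}. lborel) W"
    if "HR_precision \<Gamma> k $ i $ j = 0"
    unfolding iff using fibre_mass_product[OF that measurable_space[OF W]] by (intro ballI AE_I2) simp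
  assume m: "m \<noteq> i" "m \<noteq> j" and ci: "cond_indep_var N borel X borel Z (\<Pi>\<^sub>M l\<in>UNIV - {i, j}. lborel) W"
  show "HR_precision \<Gamma> k $ i $ j = 0"
  proof (rule ccontr)
    assume c: "HR_precision \<Gamma> k $ i $ j \<noteq> 0"
    define U V where "U = {3<..<4::real}" and "V = {1<..<3 / 2::real}"
    have UV: "U \<in> sets borel" "V \<in> sets borel" by (simp_all add: U_def V_def)
    have AE: "AE \<omega> in N. J A B (W \<omega>) * J UNIV UNIV (W \<omega>) = J A UNIV (W \<omega>) * J UNIV B (W \<omega>)"
      if "A \<in> sets borel" "B \<in> sets borel" for A B
      using ci that unfolding iff by blast
    \<comment> \<open>Only four exceptional null sets are merged. At a common good point,
      multiplying the identities in pairs produces the same four marginal masses on both sides,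
      which leaves an equality of joint masses.\<close>
    have "AE \<omega> in N. False"
      using AE_fibre_mass AE[OF UV(1) UV(1)] AE[OF UV(2) UV(2)] AE[OF UV] AE[OF UV(2) UV(1)] AE_space
    proof eventually_elim
      fix \<omega>
      let ?t = "J UNIV UNIV (W \<omega>)"
      assume pos: "0 < fibre_mass (lborel \<Otimes>\<^sub>M lborel) \<phi> (space (lborel \<Otimes>\<^sub>M lborel)) (W \<omega>)
          \<and> fibre_mass (lborel \<Otimes>\<^sub>M lborel) \<phi> (space (lborel \<Otimes>\<^sub>M lborel)) (W \<omega>) < top"
        and eqs: "J U U (W \<omega>) * ?t = J U UNIV (W \<omega>) * J UNIV U (W \<omega>)"
          "J V V (W \<omega>) * ?t = J V UNIV (W \<omega>) * J UNIV V (W \<omega>)"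
          "J U V (W \<omega>) * ?t = J U UNIV (W \<omega>) * J UNIV V (W \<omega>)"
          "J V U (W \<omega>) * ?t = J V UNIV (W \<omega>) * J UNIV U (W \<omega>)"
        and \<omega>: "\<omega> \<in> space N"
      have t: "0 < ?t" "?t < top" using pos by (simp_all add: space_pair_measure)
      have "(J U U (W \<omega>) * ?t) * (J V V (W \<omega>) * ?t) = (J U V (W \<omega>) * ?t) * (J V U (W \<omega>) * ?t)"
        unfolding eqs by (simp only: ac_simps)
      then have "(?t * ?t) * (J U U (W \<omega>) * J V V (W \<omega>)) = (?t * ?t) * (J U V (W \<omega>) * J V U (W \<omega>))"
        by (simp only: ac_simps)
      moreover have "?t * ?t \<noteq> 0" "?t * ?t \<noteq> top" using t by (auto simp: ennreal_mult_eq_top_iff)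
      ultimately have "J U U (W \<omega>) * J V V (W \<omega>) = J U V (W \<omega>) * J V U (W \<omega>)"
        unfolding ennreal_mult_cancel_left by blast
      then show False
        using fibre_mass_cross_ratio[OF c m measurable_space[OF W \<omega>] t] unfolding U_def V_def by blast
    qed
    then show False by simp
  qed
qed

end


lemma HR_precision_eq_0_iff:
  assumes "i \<noteq> j"
  shows "HR_precision \<Gamma> k $ i $ j = 0 \<longleftrightarrow>
    (if i \<noteq> k \<and> j \<noteq> k then HR_Theta \<Gamma> k i j = 0
     else if i = k then (\<Sum>l\<in>UNIV - {k}. HR_Theta \<Gamma> k l j) = 0
     else (\<Sum>l\<in>UNIV - {k}. HR_Theta \<Gamma> k i l) = 0)"
  using assms by (auto simp: HR_precision_def)

theorem proposition3:
  fixes M :: "'a measure" and Y :: "'a \<Rightarrow> real^'n" and \<Gamma> :: "real^'n^'n" and k\<^sub>0 i j k :: 'n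
  assumes "CARD('n) \<ge> 3"
    and "prob_space M"
    and "HR_parameter_matrix \<Gamma>"
    and "HR_Pareto M Y \<Gamma> k\<^sub>0"
    and "i \<noteq> j"
  shows "extremal_cond_indep M Y i j \<longleftrightarrow>
    (if i \<noteq> k \<and> j \<noteq> k then HR_Theta \<Gamma> k i j = 0
     else if i = k then (\<Sum>l\<in>UNIV - {k}. HR_Theta \<Gamma> k l j) = 0
     else (\<Sum>l\<in>UNIV - {k}. HR_Theta \<Gamma> k i l) = 0)"
proof -
  let ?N = "\<lambda>m. uniform_measure M {\<omega> \<in> space M. Y \<omega> $ m > 1}"
  let ?W = "\<lambda>\<omega>. \<lambda>l\<in>UNIV - {i, j}. Y \<omega> $ l"
  let ?CI = "\<lambda>m. cond_indep_var (?N m) borel (\<lambda>\<omega>. Y \<omega> $ i) borel (\<lambda>\<omega>. Y \<omega> $ j)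
    (\<Pi>\<^sub>M l\<in>UNIV - {i, j}. lborel) ?W"
  have sets_eq: "sets (\<Pi>\<^sub>M l\<in>UNIV - {i, j}. borel :: real measure) = sets (\<Pi>\<^sub>M l\<in>UNIV - {i, j}. lborel)"
    by (rule sets_PiM_cong) simp_all
  have extremal: "extremal_cond_indep M Y i j \<longleftrightarrow> (\<forall>m. ?CI m)"
    unfolding extremal_cond_indep_def cond_indep_var_cong_sets[OF sets_eq] ..
  have Y: "Y \<in> M \<rightarrow>\<^sub>M borel"
    using assms(4) distributed_measurable unfolding HR_Pareto_def by fastforce
  have CI: "HR_precision \<Gamma> k\<^sub>0 $ i $ j = 0 \<Longrightarrow> ?CI m"
    "m \<noteq> i \<Longrightarrow> m \<noteq> j \<Longrightarrow> ?CI m \<Longrightarrow> HR_precision \<Gamma> k\<^sub>0 $ i $ j = 0" for m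
  proof -
    obtain a where a: "0 < a" and N: "prob_space (?N m)"
      and law: "\<And>h. h \<in> borel_measurable borel \<Longrightarrow>
        (\<integral>\<^sup>+\<omega>. h (Y \<omega>) \<partial>?N m) = (\<integral>\<^sup>+y. ennreal (a * HR_kernel \<Gamma> k\<^sub>0 m y) * h y \<partial>lborel)"
      by (rule HR_Pareto_conditional_law[OF assms(2-4), of m]) blast
    have Y': "Y \<in> ?N m \<rightarrow>\<^sub>M borel"
      using Y by (simp cong: measurable_cong_sets)
    have \<kappa>: "(\<lambda>y. ennreal (a * HR_kernel \<Gamma> k\<^sub>0 m y)) \<in> borel_measurable borel" by measurable
    note * = cond_indep_var_iff_HR_precision[OF assms(3,5) a joint_density_insert_pair[OF N Y' \<kappa> assms(5) law]]
    show "HR_precision \<Gamma> k\<^sub>0 $ i $ j = 0 \<Longrightarrow> ?CI m"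
      by (rule *(1))
    show "m \<noteq> i \<Longrightarrow> m \<noteq> j \<Longrightarrow> ?CI m \<Longrightarrow> HR_precision \<Gamma> k\<^sub>0 $ i $ j = 0"
      by (rule *(2))
  qed
  have "card {i, j} \<le> 2" by (simp add: card_insert_if)
  then have "{i, j} \<noteq> UNIV" using assms(1) by force
  then obtain m where "m \<noteq> i" "m \<noteq> j" by blast
  then have "extremal_cond_indep M Y i j \<longleftrightarrow> HR_precision \<Gamma> k\<^sub>0 $ i $ j = 0"
    unfolding extremal using CI by blast
  then show ?thesis
    \<comment> \<open>Here the index of the density is exchanged for the index of the
      criterion.\<close>
    unfolding HR_precision_independent[OF assms(3), of k\<^sub>0 k] HR_precision_eq_0_iff[OF assms(5)] .
qed

end
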